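(* Let $p$ be an odd prime. Let $m\ge 5$ be an integer such that either $m$ is odd, or $m$ is even and $m\ge p+3$. Then there exists a non-tight chiral polyhedron $\mathcal{P}$ with $|\mathrm{Aut}(\mathcal{P})|=2p^m$.
   Context: Abstract polyhedra. An abstract polyhedron (abstract polytope of rank $3$) is a partially ordered set $\mathcal{P}$ with a strictly monotone rank function with range $\{-1,0,1,2,3\}$ such that: (P1) there is a least face $F_{-1}$ and a greatest face $F_3$; (P2) every flag (maximal chain) contains exactly $5$ elements; (P3) any two flags $\Phi,\Psi$ can be joined by a sequence of flags $\Phi=\Phi_0,\dots,\Phi_k=\Psi$, each containing $\Phi\cap\Psi$, with consecutive flags differing in exactly one element; (P4) if $F<G$ have ranks $i-1$ and $i+1$ with $0\le i\le 2$, there are exactly two elements $H$ of rank $i$ with $F<H<G$. For a flag $\Phi$ and $i\in\{0,1,2\}$, $\Phi^i$ denotes the unique flag differing from $\Phi$ exactly in its element of rank $i$ (the $i$-adjacent flag). $\mathrm{Aut}(\mathcal{P})$ is the group of order-preserving permutations of $\mathcal{P}$ (acting on the right). $\mathcal{P}$ is chiral if $\mathrm{Aut}(\mathcal{P})$ has exactly two orbits on flags and adjacent flags always lie in different orbits. Then $\mathcal{P}$ is equivelar: it has type $\{k_1,k_2\}$ (an ordered pair), where $k_1$ is the number of edges of each $2$-face and $k_2$ is the valency of each vertex. Fix a base flag $\Phi$. The distinguished generators of $G=\mathrm{Aut}(\mathcal{P})$ are the automorphisms $\sigma_1,\sigma_2$ with $\sigma_j$ taking $\Phi$ to $(\Phi^{j})^{j-1}$;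 $\sigma_1,\sigma_2$ have orders $k_1,k_2$. Standard group-theoretic characterization (Schulte–Weiss): a finite group $G$ with elements $\sigma_1,\sigma_2$ is of the form $(\mathrm{Aut}(\mathcal{P}),\{\sigma_1,\sigma_2\})$ for a chiral polyhedron $\mathcal{P}$ of type $\{k_1,k_2\}$ if and only if $G=\langle\sigma_1,\sigma_2\rangle$, $\sigma_1,\sigma_2,\sigma_1\sigma_2$ have orders $k_1,k_2,2$, $\langle\sigma_1\rangle\cap\langle\sigma_2\rangle=\{1\}$, and there is no automorphism $\alpha$ of $G$ with $\sigma_1^\alpha=\sigma_1^{-1}$ and $\sigma_2^\alpha=\sigma_2^{-1}$. The polyhedron $\mathcal{P}$ of type $\{k_1,k_2\}$ is tight if $|\mathrm{Aut}(\mathcal{P})|=k_1k_2$, and non-tight otherwise. *)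

theory Defs
  imports "HOL-Algebra.Group_Action" "HOL-Computational_Algebra.Primes"
begin

text \<open>
  A poset is a carrier \<open>P\<close> together with the graph \<open>r\<close> of its (reflexive) order relation,
  so \<open>x < y\<close> reads \<open>(x, y) \<in> r \<and> x \<noteq> y\<close>.
\<close>

definition flags :: "('a \<times> 'a) set \<Rightarrow> 'a set set" where
  "flags r = {\<Phi> \<in> Chains r. \<forall>\<Psi> \<in> Chains r. \<Phi> \<subseteq> \<Psi> \<longrightarrow> \<Psi> = \<Phi>}"

definition adjacent_flags :: "('a \<times> 'a) set \<Rightarrow> 'a set \<Rightarrow> 'a set \<Rightarrow> bool" where
  "adjacent_flags r \<Phi> \<Psi> \<longleftrightarrow>
     \<Phi> \<in> flags r \<and> \<Psi> \<in> flags r \<and> card (\<Phi> - \<Psi>) = 1 \<and> card (\<Psi> - \<Phi>) = 1"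

locale abstract_polyhedron =
  fixes P :: "'a set" and r :: "('a \<times> 'a) set" and rk :: "'a \<Rightarrow> int"
  assumes partial_order: "partial_order_on P r"
    and rank_strict_mono: "\<And>x y. (x, y) \<in> r \<Longrightarrow> x \<noteq> y \<Longrightarrow> rk x < rk y"
    and rank_range: "rk ` P = {-1..3}"
    and least_face: "\<exists>F \<in> P. \<forall>x \<in> P. (F, x) \<in> r"
    and greatest_face: "\<exists>F \<in> P. \<forall>x \<in> P. (x, F) \<in> r"
    and flag_card: "\<And>\<Phi>. \<Phi> \<in> flags r \<Longrightarrow> card \<Phi> = 5"
    and strongly_connected:
      "\<And>\<Phi> \<Psi>. \<Phi> \<in> flags r \<Longrightarrow> \<Psi> \<in> flags r \<Longrightarrow>
         \<exists>(k::nat) s. s 0 = \<Phi> \<and> s k = \<Psi> \<and>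
           (\<forall>i\<le>k. s i \<in> flags r \<and> \<Phi> \<inter> \<Psi> \<subseteq> s i) \<and>
           (\<forall>i<k. adjacent_flags r (s i) (s (Suc i)))"
    and diamond:
      "\<And>F G i. i \<in> {0..2} \<Longrightarrow> F \<in> P \<Longrightarrow> G \<in> P \<Longrightarrow> (F, G) \<in> r \<Longrightarrow> F \<noteq> G \<Longrightarrow>
         rk F = i - 1 \<Longrightarrow> rk G = i + 1 \<Longrightarrow>
         card {H \<in> P. rk H = i \<and> (F, H) \<in> r \<and> F \<noteq> H \<and> (H, G) \<in> r \<and> H \<noteq> G} = 2"

text \<open>
  The multiplication is that of \<^const>\<open>BijGroup\<close>, i.e. automorphisms act on the left. Acting on the
  right gives the opposite group, which has the same order and the same orbits.
\<close>

definition poset_aut :: "'a set \<Rightarrow> ('a \<times> 'a) set \<Rightarrow> ('a \<Rightarrow> 'a) monoid" where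
  "poset_aut P r = BijGroup P
     \<lparr>carrier := {f \<in> Bij P. \<forall>x \<in> P. \<forall>y \<in> P. (x, y) \<in> r \<longleftrightarrow> (f x, f y) \<in> r}\<rparr>"

definition flag_orbit :: "'a set \<Rightarrow> ('a \<times> 'a) set \<Rightarrow> 'a set \<Rightarrow> 'a set set" where
  "flag_orbit P r \<Phi> = orbit (poset_aut P r) image \<Phi>"

locale chiral_polyhedron = abstract_polyhedron +
  assumes two_flag_orbits: "card (orbits (poset_aut P r) (flags r) image) = 2"
    and adjacent_distinct_orbits:
      "\<And>\<Phi> \<Psi>. adjacent_flags r \<Phi> \<Psi> \<Longrightarrow> flag_orbit P r \<Phi> \<noteq> flag_orbit P r \<Psi>"

definition has_type :: "'a set \<Rightarrow> ('a \<times> 'a) set \<Rightarrow> ('a \<Rightarrow> int) \<Rightarrow> nat \<Rightarrow> nat \<Rightarrow> bool" where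
  "has_type P r rk k1 k2 \<longleftrightarrow>
     (\<forall>F \<in> P. rk F = 2 \<longrightarrow>
        finite {E \<in> P. rk E = 1 \<and> (E, F) \<in> r} \<and> card {E \<in> P. rk E = 1 \<and> (E, F) \<in> r} = k1) \<and>
     (\<forall>v \<in> P. rk v = 0 \<longrightarrow>
        finite {E \<in> P. rk E = 1 \<and> (v, E) \<in> r} \<and> card {E \<in> P. rk E = 1 \<and> (v, E) \<in> r} = k2)"

definition tight :: "'a set \<Rightarrow> ('a \<times> 'a) set \<Rightarrow> ('a \<Rightarrow> int) \<Rightarrow> bool" where
  "tight P r rk \<longleftrightarrow>
     (\<exists>k1 k2. has_type P r rk k1 k2 \<and> card (carrier (poset_aut P r)) = k1 * k2)"

text \<open>
  Tightness is only defined for polyhedra that have a type, so \<open>non_tight\<close> includes having one.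
  Lemma \<open>non_tight_iff\<close> below shows that this is the only difference from \<open>\<not> tight\<close>.
\<close>

definition non_tight :: "'a set \<Rightarrow> ('a \<times> 'a) set \<Rightarrow> ('a \<Rightarrow> int) \<Rightarrow> bool" where
  "non_tight P r rk \<longleftrightarrow>
     (\<exists>k1 k2. has_type P r rk k1 k2 \<and> card (carrier (poset_aut P r)) \<noteq> k1 * k2)"

lemma (in abstract_polyhedron) has_type_unique:
  assumes "has_type P r rk k1 k2" "has_type P r rk l1 l2"
  shows "k1 = l1 \<and> k2 = l2"
proof -
  have "2 \<in> rk ` P" "0 \<in> rk ` P"
    unfolding rank_range by auto
  then obtain F v where "F \<in> P" "rk F = 2" "v \<in> P" "rk v = 0"
    by force
  then show ?thesis
    using assms unfolding has_type_def by blast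
qed

lemma (in abstract_polyhedron) non_tight_iff:
  "non_tight P r rk \<longleftrightarrow> (\<exists>k1 k2. has_type P r rk k1 k2) \<and> \<not> tight P r rk"
  unfolding non_tight_def tight_def using has_type_unique by blast

lemma group_poset_aut: "group (poset_aut P r)"
proof -
  let ?A = "{f \<in> Bij P. \<forall>x \<in> P. \<forall>y \<in> P. (x, y) \<in> r \<longleftrightarrow> (f x, f y) \<in> r}"
  have mem: "f x \<in> P" if "f \<in> Bij P" "x \<in> P" for f x
    using that Bij_imp_funcset by blast
  have "subgroup ?A (BijGroup P)"
  proof (rule group.subgroupI[OF group_BijGroup])
    show "?A \<subseteq> carrier (BijGroup P)"
      by (auto simp: BijGroup_def)
    have "(\<lambda>x\<in>P. x) \<in> ?A"
      using id_Bij by auto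
    then show "?A \<noteq> {}" by blast
  next
    fix f assume f: "f \<in> ?A"
    then have f_inv: "f (inv_into P f x) = x" if "x \<in> P" for x
      using that by (simp add: Bij_def bij_betw_def f_inv_into_f)
    have "(x, y) \<in> r \<longleftrightarrow> (inv_into P f x, inv_into P f y) \<in> r" if xy: "x \<in> P" "y \<in> P" for x y
    proof -
      have "inv_into P f x \<in> P" "inv_into P f y \<in> P"
        using f xy by (simp_all add: Bij_inv_into_mem)
      then have "(inv_into P f x, inv_into P f y) \<in> r \<longleftrightarrow>
          (f (inv_into P f x), f (inv_into P f y)) \<in> r"
        using f by blast
      then show ?thesis
        by (simp add: f_inv xy)
    qed
    then show "inv\<^bsub>BijGroup P\<^esub> f \<in> ?A"
      using f by (auto simp: inv_BijGroup restrict_inv_into_Bij)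
  next
    fix f g assume "f \<in> ?A" "g \<in> ?A"
    then show "f \<otimes>\<^bsub>BijGroup P\<^esub> g \<in> ?A"
      using mem by (auto simp: BijGroup_def compose_Bij compose_eq)
  qed
  then show ?thesis
    unfolding poset_aut_def by (rule subgroup.subgroup_is_group[OF _ group_BijGroup])
qed

end

theory Submission
  imports Defs "HOL-Algebra.Multiplicative_Group" "HOL-Library.Product_Plus"
begin

text \<open>
  A chiral polyhedron is the geometry of left cosets of \<open>\<langle>\<sigma>\<^sub>2\<rangle>\<close>, \<open>\<langle>\<sigma>\<^sub>1\<sigma>\<^sub>2\<rangle>\<close>, \<open>\<langle>\<sigma>\<^sub>1\<rangle>\<close> in a suitable group.
  We use \<open>A \<rtimes> C\<close>, where \<open>A\<close> is a finite module over \<open>\<int>[U]\<close>, cyclic with generator \<open>e\<^sub>0\<close>, in which \<open>U\<close>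
  acts with order dividing the odd number \<open>q\<close>, and the generator \<open>c\<close> of the cyclic group \<open>C\<close> of order
  \<open>2q\<close> acts as \<open>- U\<close>. With \<open>t = (e\<^sub>0, c\<^sup>q)\<close>, an involution because \<open>c\<^sup>q\<close> acts as \<open>- 1\<close>, take
  \<open>\<sigma>\<^sub>1 = t c\<close> and \<open>\<sigma>\<^sub>2 = c\<^sup>-\<^sup>1\<close>. An automorphism of the group that inverts both generators
  would induce an additive endomorphism of \<open>A\<close> that fixes \<open>e\<^sub>0\<close> and conjugates \<open>U\<close> to \<open>U\<^sup>-\<^sup>1\<close>, so the
  polyhedron is chiral as soon as some relation between the elements \<open>U\<^sup>j e\<^sub>0\<close> fails after
  replacing \<open>U\<close> by \<open>U\<^sup>-\<^sup>1\<close>. Writing \<open>U = 1 + z\<close>, such a relation is \<open>p\<^bsup>m-4\<^esup> = p z\<close> when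
  \<open>z\<^sup>2 = 0\<close> (for \<open>m \<ge> 6\<close>) and \<open>p = z\<^sup>3\<close> (for \<open>m = 5\<close>, \<open>p \<ge> 5\<close>); the remaining case \<open>m = 5\<close>, \<open>p = 3\<close>
  uses \<open>U\<^sup>2 = 5 U - 7\<close> over \<open>\<int>/9\<close>, where \<open>U\<close> has norm \<open>7 \<noteq> 1\<close>.
\<close>

section \<open>Coset geometries of rotary groups\<close>

text \<open>In the usual notation \<open>t = \<sigma>\<^sub>1\<sigma>\<^sub>2\<close> and \<open>c = \<sigma>\<^sub>2\<^sup>-\<^sup>1\<close>, so that \<open>t \<otimes> c = \<sigma>\<^sub>1\<close>.\<close>

locale rotary_group = group G for G (structure) +
  fixes t c :: 'a
  assumes finite_carrier: "finite (carrier G)"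
    and t_closed [simp, intro]: "t \<in> carrier G"
    and c_closed [simp, intro]: "c \<in> carrier G"
    and t_t: "t \<otimes> t = \<one>"
    and c_neq_one: "c \<noteq> \<one>"
    and tc_neq_one: "t \<otimes> c \<noteq> \<one>"
    and generators: "generate G {t, c} = carrier G"
    and intersection: "generate G {t \<otimes> c} \<inter> generate G {c} = {\<one>}"
begin

text \<open>Ranks -1 and 3 get the whole group, so that each of them has a single coset; all other
  integers share this default.\<close>

definition face_stabilizer :: "int \<Rightarrow> 'a set" where
  "face_stabilizer i =
     (if i = 0 then generate G {c} else if i = 1 then {\<one>, t}
      else if i = 2 then generate G {t \<otimes> c} else carrier G)"

lemma inv_t [simp]: "inv t = t"
  using t_t by (simp add: inv_equality)

lemma mult_t_t [simp]: "g \<in> carrier G \<Longrightarrow> g \<otimes> t \<otimes> t = g"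
  by (simp add: m_assoc t_t)

lemma mult_c_inv [simp]: "g \<in> carrier G \<Longrightarrow> g \<otimes> c \<otimes> inv c = g" "g \<in> carrier G \<Longrightarrow> g \<otimes> inv c \<otimes> c = g"
  by (simp_all add: m_assoc)

lemma subgroup_stabilizer: "subgroup (face_stabilizer i) G"
proof -
  have "subgroup {\<one>, t} G"
    by (rule subgroupI) (auto simp: t_t)
  then show ?thesis
    by (auto simp: face_stabilizer_def generate_is_subgroup subgroup_self)
qed

lemma stabilizer_subset: "face_stabilizer i \<subseteq> carrier G"
  using subgroup.subset[OF subgroup_stabilizer] .

lemma one_stabilizer [simp]: "\<one> \<in> face_stabilizer i"
  using subgroup.one_closed[OF subgroup_stabilizer] .

lemma t_stabilizer [simp]: "t \<in> face_stabilizer 1"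
  by (simp add: face_stabilizer_def)

lemma c_stabilizer [simp]: "c \<in> face_stabilizer 0"
  by (simp add: face_stabilizer_def generate.incl)

lemma tc_stabilizer [simp]: "t \<otimes> c \<in> face_stabilizer 2"
  by (simp add: face_stabilizer_def generate.incl)

lemma c_notin_stabilizer_2: "c \<notin> face_stabilizer 2"
  using intersection c_neq_one c_stabilizer by (auto simp: face_stabilizer_def)

lemma t_notin_stabilizer_0: "t \<notin> face_stabilizer 0"
proof
  assume "t \<in> face_stabilizer 0"
  then have "t \<otimes> c \<in> face_stabilizer 0"
    using subgroup.m_closed[OF subgroup_stabilizer] by simp
  then show False
    using tc_stabilizer intersection tc_neq_one by (auto simp: face_stabilizer_def)
qed

lemma t_notin_stabilizer_2: "t \<notin> face_stabilizer 2"
proof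
  assume "t \<in> face_stabilizer 2"
  then have "t \<otimes> (t \<otimes> c) \<in> face_stabilizer 2"
    using subgroup.m_closed[OF subgroup_stabilizer] by simp
  moreover have "t \<otimes> (t \<otimes> c) = c"
    by (simp add: m_assoc[symmetric] t_t)
  ultimately show False
    using c_notin_stabilizer_2 by simp
qed

lemma c_notin_stabilizer_1: "c \<notin> face_stabilizer 1"
  using c_neq_one tc_neq_one t_t by (auto simp: face_stabilizer_def)

lemma inv_c_notin_stabilizer_1: "inv c \<notin> face_stabilizer 1"
  using c_notin_stabilizer_1 subgroup.m_inv_closed[OF subgroup_stabilizer, of "inv c" 1] by auto

text \<open>Since \<open>t\<close> lies in neither cyclic group, the intersection hypothesis extends
  to all three pairs of stabilizers.\<close>

lemma stabilizer_inter:
  assumes "i \<in> {0..2}" "j \<in> {0..2}" "i \<noteq> j" "x \<in> face_stabilizer i" "x \<in> face_stabilizer j"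
  shows "x = \<one>"
proof -
  have "i = 0 \<or> i = 1 \<or> i = 2" "j = 0 \<or> j = 1 \<or> j = 2"
    using assms by auto
  moreover have "x = \<one>" if "x \<in> face_stabilizer 0" "x \<in> face_stabilizer 2" for x
    using intersection that by (auto simp: face_stabilizer_def)
  moreover have "x = \<one>" if "x \<in> face_stabilizer 0" "x \<in> face_stabilizer 1" for x
    using t_notin_stabilizer_0 that by (auto simp: face_stabilizer_def)
  moreover have "x = \<one>" if "x \<in> face_stabilizer 1" "x \<in> face_stabilizer 2" for x
    using t_notin_stabilizer_2 that by (auto simp: face_stabilizer_def)
  ultimately show ?thesis
    using assms by blast
qed

text \<open>In a finite group every element is a product of factors \<open>t\<close> and
  \<open>inv c\<close>. These are the two moves along which automorphisms are followed
  later.\<close>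

lemma carrier_induct [consumes 1, case_names one t inv_c]:
  assumes "g \<in> carrier G" "Q \<one>"
    and t: "\<And>g. g \<in> carrier G \<Longrightarrow> Q g \<Longrightarrow> Q (g \<otimes> t)"
    and c: "\<And>g. g \<in> carrier G \<Longrightarrow> Q g \<Longrightarrow> Q (g \<otimes> inv c)"
  shows "Q g"
proof -
  \<comment> \<open>\<open>H\<close> collects the right factors that preserve \<open>Q\<close>. It
    is closed under products, hence under inverses, which are powers with exponent
    \<open>order G - 1\<close>.\<close>
  define H where "H = {h \<in> carrier G. \<forall>g \<in> carrier G. Q g \<longrightarrow> Q (g \<otimes> h)}"
  have one: "\<one> \<in> H" by (simp add: H_def)
  have mult: "h \<otimes> k \<in> H" if "h \<in> H" "k \<in> H" for h k
    using that by (auto simp: H_def m_assoc[symmetric])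
  have pow: "h [^] (n::nat) \<in> H" if "h \<in> H" for h n
    by (induction n) (auto simp: that one mult)
  have inv: "inv h \<in> H" if "h \<in> H" for h
  proof -
    have h: "h \<in> carrier G" using that by (simp add: H_def)
    have "order G > 0"
      using finite_carrier order_gt_0_iff_finite by blast
    then have "h [^] (order G - 1) \<otimes> h = \<one>"
      using pow_order_eq_1[OF h] nat_pow_Suc[of h "order G - 1"] by simp
    then have "inv h = h [^] (order G - 1)"
      using h by (simp add: inv_equality)
    then show ?thesis using pow[OF that] by simp
  qed
  have "inv c \<in> H" "t \<in> H" using t c by (auto simp: H_def)
  then have "c \<in> H" using inv[of "inv c"] by simp
  have "x \<in> H" if "x \<in> generate G {t, c}" for x
    using that by induction (use \<open>c \<in> H\<close> \<open>t \<in> H\<close> one inv mult in auto)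
  then have "g \<in> H" using assms generators by auto
  then have "Q (\<one> \<otimes> g)" using assms by (auto simp: H_def)
  then show ?thesis using assms by simp
qed

end

text \<open>
  \<open>fc i g\<close> stands for the left coset of \<open>face_stabilizer i\<close> containing \<open>g\<close>, as a face of rank \<open>i\<close>. Two
  faces are incident if their cosets meet, hence the definition of \<open>face_order\<close> below.
\<close>

locale coset_geometry = rotary_group +
  fixes fc :: "int \<Rightarrow> 'a \<Rightarrow> 'f"
  assumes fc_eq_iff: "\<And>i j g h. i \<in> {-1..3} \<Longrightarrow> j \<in> {-1..3} \<Longrightarrow> g \<in> carrier G \<Longrightarrow> h \<in> carrier G \<Longrightarrow>
    fc i g = fc j h \<longleftrightarrow> i = j \<and> inv g \<otimes> h \<in> face_stabilizer i"
begin

definition faces :: "'f set" where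
  "faces = {fc i g | i g. i \<in> {-1..3} \<and> g \<in> carrier G}"

definition face_order :: "('f \<times> 'f) set" where
  "face_order = {(fc i g, fc j g) | i j g. -1 \<le> i \<and> i \<le> j \<and> j \<le> 3 \<and> g \<in> carrier G}"

definition face_rank :: "'f \<Rightarrow> int" where
  "face_rank x = (THE i. i \<in> {-1..3} \<and> (\<exists>g \<in> carrier G. x = fc i g))"

section \<open>Cosets as faces: equality and common representatives\<close>

lemma fc_eqI: "i \<in> {-1..3} \<Longrightarrow> g \<in> carrier G \<Longrightarrow> x \<in> face_stabilizer i \<Longrightarrow> fc i (g \<otimes> x) = fc i g"
  using stabilizer_subset[of i] fc_eq_iff[of i i g "g \<otimes> x"]
  by (auto simp: m_assoc[symmetric] subset_eq)

lemma fc_eqE: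
  assumes "i \<in> {-1..3}" "g \<in> carrier G" "h \<in> carrier G" "fc i g = fc i h"
  obtains x where "x \<in> face_stabilizer i" "h = g \<otimes> x"
proof
  show "inv g \<otimes> h \<in> face_stabilizer i" using assms fc_eq_iff[of i i g h] by auto
  show "h = g \<otimes> (inv g \<otimes> h)" using assms by (simp add: m_assoc[symmetric])
qed

lemma fc_mult_eq_iff:
  "i \<in> {-1..3} \<Longrightarrow> g \<in> carrier G \<Longrightarrow> x \<in> carrier G \<Longrightarrow> fc i (g \<otimes> x) = fc i g \<longleftrightarrow> x \<in> face_stabilizer i"
  using fc_eq_iff[of i i g "g \<otimes> x"] by (auto simp: m_assoc[symmetric])

lemma fc_rank_eq: "fc i g = fc j h \<Longrightarrow> i \<in> {-1..3} \<Longrightarrow> j \<in> {-1..3} \<Longrightarrow> g \<in> carrier G \<Longrightarrow> h \<in> carrier G \<Longrightarrow> i = j"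
  using fc_eq_iff by blast

lemma fc_left_mult_iff:
  assumes "i \<in> {-1..3}" "g \<in> carrier G" "h \<in> carrier G" "k \<in> carrier G"
  shows "fc i (k \<otimes> g) = fc i (k \<otimes> h) \<longleftrightarrow> fc i g = fc i h"
proof -
  have "inv (k \<otimes> g) \<otimes> (k \<otimes> h) = inv g \<otimes> (inv k \<otimes> (k \<otimes> h))"
    using assms by (simp add: inv_mult_group m_assoc)
  also have "\<dots> = inv g \<otimes> h"
    using assms by (simp add: m_assoc[symmetric])
  finally show ?thesis
    using assms by (simp add: fc_eq_iff)
qed

text \<open>Cosets of two different proper stabilizers share at most one element, because the
  stabilizers intersect trivially. This ties flags to group elements.\<close>

lemma fc_meet:
  assumes "i \<in> {0..2}" "j \<in> {0..2}" "i \<noteq> j" "g \<in> carrier G" "h \<in> carrier G"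
    "fc i g = fc i h" "fc j g = fc j h"
  shows "g = h"
proof -
  have "inv g \<otimes> h \<in> face_stabilizer i" "inv g \<otimes> h \<in> face_stabilizer j"
    using assms fc_eq_iff[of i i g h] fc_eq_iff[of j j g h] by auto
  then have "inv g \<otimes> h = \<one>"
    using assms stabilizer_inter by blast
  then show ?thesis
    using assms by (metis inv_closed inv_equality inv_inv)
qed

lemma fc_mult_t [simp]: "g \<in> carrier G \<Longrightarrow> fc 1 (g \<otimes> t) = fc 1 g"
  by (simp add: fc_eqI)

lemma fc_mult_c [simp]: "g \<in> carrier G \<Longrightarrow> fc 0 (g \<otimes> c) = fc 0 g"
  by (simp add: fc_eqI)

lemma fc_mult_inv_c [simp]: "g \<in> carrier G \<Longrightarrow> fc 0 (g \<otimes> inv c) = fc 0 g"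
  using fc_mult_c[of "g \<otimes> inv c"] by simp

lemma fc_2_t_c [simp]: "g \<in> carrier G \<Longrightarrow> fc 2 (g \<otimes> t \<otimes> c) = fc 2 g"
  using fc_eqI[of 2 g "t \<otimes> c"] by (simp add: m_assoc[symmetric])

text \<open>Here \<open>g \<otimes> c\<close> is \<open>g \<otimes> t\<close> times
  \<open>t \<otimes> c\<close>. So \<open>g \<otimes> c\<close> represents both the vertex of
  \<open>g\<close> and the 2-face across the edge of \<open>g\<close>, a witness used repeatedly
  below.\<close>

lemma fc_2_c [simp]: "g \<in> carrier G \<Longrightarrow> fc 2 (g \<otimes> c) = fc 2 (g \<otimes> t)"
  using fc_2_t_c[of "g \<otimes> t"] by simp

lemma fc_2_inv_c_t [simp]: "g \<in> carrier G \<Longrightarrow> fc 2 (g \<otimes> inv c \<otimes> t) = fc 2 g"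
  using fc_2_c[of "g \<otimes> inv c"] by simp

lemma fc_improper: "g \<in> carrier G \<Longrightarrow> h \<in> carrier G \<Longrightarrow> i \<in> {-1, 3} \<Longrightarrow> fc i g = fc i h"
  using fc_eq_iff[of i i g h] by (auto simp: face_stabilizer_def)

lemma fc_in_faces [simp, intro]: "i \<in> {-1..3} \<Longrightarrow> g \<in> carrier G \<Longrightarrow> fc i g \<in> faces"
  by (auto simp: faces_def)

lemma facesE:
  assumes "x \<in> faces"
  obtains i g where "i \<in> {-1..3}" "g \<in> carrier G" "x = fc i g"
  using assms by (auto simp: faces_def)

lemma face_rank_fc [simp]:
  assumes "-1 \<le> i" "i \<le> 3" "g \<in> carrier G"
  shows "face_rank (fc i g) = i"
  unfolding face_rank_def
proof (rule the_equality)
  show "i \<in> {-1..3} \<and> (\<exists>h \<in> carrier G. fc i g = fc i h)"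
    using assms by auto
qed (use assms fc_rank_eq[of i g] in auto)

lemma face_orderI: "-1 \<le> i \<Longrightarrow> i \<le> j \<Longrightarrow> j \<le> 3 \<Longrightarrow> g \<in> carrier G \<Longrightarrow> (fc i g, fc j g) \<in> face_order"
  by (auto simp: face_order_def)

lemma face_orderE:
  assumes "(x, y) \<in> face_order"
  obtains i j g where "-1 \<le> i" "i \<le> j" "j \<le> 3" "g \<in> carrier G" "x = fc i g" "y = fc j g"
  using assms by (auto simp: face_order_def)

lemma face_order_fc_iff:
  assumes "i \<in> {-1..3}" "j \<in> {-1..3}" "g \<in> carrier G" "h \<in> carrier G"
  shows "(fc i g, fc j h) \<in> face_order \<longleftrightarrow>
    i \<le> j \<and> (\<exists>k \<in> carrier G. fc i k = fc i g \<and> fc j k = fc j h)"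
proof
  assume "(fc i g, fc j h) \<in> face_order"
  then obtain i' j' k where k: "-1 \<le> i'" "i' \<le> j'" "j' \<le> 3" "k \<in> carrier G"
      and eq: "fc i g = fc i' k" "fc j h = fc j' k"
    by (rule face_orderE)
  have "i = i'" using fc_rank_eq[OF eq(1)] k assms by auto
  moreover have "j = j'" using fc_rank_eq[OF eq(2)] k assms by auto
  ultimately show "i \<le> j \<and> (\<exists>k \<in> carrier G. fc i k = fc i g \<and> fc j k = fc j h)"
    using k eq by metis
next
  assume "i \<le> j \<and> (\<exists>k \<in> carrier G. fc i k = fc i g \<and> fc j k = fc j h)"
  then obtain k where "i \<le> j" "k \<in> carrier G" "fc i k = fc i g" "fc j k = fc j h" by blast
  then show "(fc i g, fc j h) \<in> face_order"
    using face_orderI[of i j k] assms by auto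
qed

lemma face_order_subset: "face_order \<subseteq> faces \<times> faces"
  by (auto simp: face_order_def)

section \<open>Incidences around an edge and at a corner, and the partial order\<close>

lemma edge_eqD:
  assumes "g \<in> carrier G" "h \<in> carrier G" "fc 1 g = fc 1 h"
  shows "h = g \<or> h = g \<otimes> t"
proof -
  obtain x where "x \<in> face_stabilizer 1" "h = g \<otimes> x"
    using fc_eqE[OF _ assms] by auto
  then show ?thesis
    using assms by (auto simp: face_stabilizer_def)
qed

lemma faces_of_edge:
  assumes "g \<in> carrier G" "(fc 1 g, y) \<in> face_order" "face_rank y = 2"
  shows "y = fc 2 g \<or> y = fc 2 (g \<otimes> t)"
proof -
  obtain i j h where h: "-1 \<le> i" "i \<le> j" "j \<le> 3" "h \<in> carrier G" "fc 1 g = fc i h" "y = fc j h"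
    using assms(2) by (rule face_orderE)
  then have "i = 1" "j = 2" using assms fc_rank_eq[of 1 g i h] by auto
  then show ?thesis using edge_eqD[of g h] h assms by auto
qed

lemma vertices_of_edge:
  assumes "g \<in> carrier G" "(y, fc 1 g) \<in> face_order" "face_rank y = 0"
  shows "y = fc 0 g \<or> y = fc 0 (g \<otimes> t)"
proof -
  obtain i j h where h: "-1 \<le> i" "i \<le> j" "j \<le> 3" "h \<in> carrier G" "y = fc i h" "fc 1 g = fc j h"
    using assms(2) by (rule face_orderE)
  then have "i = 0" "j = 1" using assms fc_rank_eq[of 1 g j h] by auto
  then show ?thesis using edge_eqD[of g h] h assms by auto
qed

text \<open>An edge coset has two elements \<open>h\<close> and \<open>h \<otimes> t\<close>. Either
  one element \<open>h\<close> lies in all three faces and equals \<open>g\<close>, or the face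
  contains \<open>h \<otimes> t\<close>; then \<open>h \<otimes> c\<close> lies in vertex and face
  and equals \<open>g\<close>.\<close>

lemma edges_at_corner:
  assumes g: "g \<in> carrier G" and "(fc 0 g, y) \<in> face_order" "(y, fc 2 g) \<in> face_order" "face_rank y = 1"
  shows "y = fc 1 g \<or> y = fc 1 (g \<otimes> inv c)"
proof -
  obtain i j h where h: "-1 \<le> i" "i \<le> j" "j \<le> 3" "h \<in> carrier G" "fc 0 g = fc i h" "y = fc j h"
    using assms(2) by (rule face_orderE)
  then have ij: "i = 0" "j = 1" using assms fc_rank_eq[of 0 g i h] by auto
  obtain i' j' k where k: "-1 \<le> i'" "i' \<le> j'" "j' \<le> 3" "k \<in> carrier G" "y = fc i' k" "fc 2 g = fc j' k"
    using assms(3) by (rule face_orderE)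
  then have ij': "i' = 1" "j' = 2" using assms fc_rank_eq[of 2 g j' k] by auto
  have "k = h \<or> k = h \<otimes> t" using edge_eqD[of h k] h k ij ij' by auto
  then show ?thesis
  proof
    assume "k = h"
    then have "h = g" using fc_meet[of 0 2 h g] h k g ij ij' by auto
    then show ?thesis using h ij by auto
  next
    assume "k = h \<otimes> t"
    then have "h \<otimes> c = g" using fc_meet[of 0 2 "h \<otimes> c" g] h k g ij ij' by auto
    then have "h = g \<otimes> inv c" using h by auto
    then show ?thesis using h ij by auto
  qed
qed

lemma partial_order_faces: "partial_order_on faces face_order"
proof -
  have refl: "refl_on faces face_order"
    by (auto simp: refl_on_def faces_def intro: face_orderI)
  have antisym: "antisym face_order"
  proof (rule antisymI)
    fix x y assume "(x, y) \<in> face_order" "(y, x) \<in> face_order"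
    then obtain i j g i' j' h where
      g: "-1 \<le> i" "i \<le> j" "j \<le> 3" "g \<in> carrier G" "x = fc i g" "y = fc j g" and
      h: "-1 \<le> i'" "i' \<le> j'" "j' \<le> 3" "h \<in> carrier G" "y = fc i' h" "x = fc j' h"
      by (elim face_orderE) blast
    then have "i = j'" "j = i'" using fc_rank_eq[of i g j' h] fc_rank_eq[of j g i' h] by auto
    then show "x = y" using g h by auto
  qed
  have trans: "trans face_order"
  proof (rule transI)
    fix x y z assume "(x, y) \<in> face_order" "(y, z) \<in> face_order"
    then obtain i j g j' k h where
      g: "-1 \<le> i" "i \<le> j" "j \<le> 3" "g \<in> carrier G" "x = fc i g" "y = fc j g" and
      h: "-1 \<le> j'" "j' \<le> k" "k \<le> 3" "h \<in> carrier G" "y = fc j' h" "z = fc k h"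
      by (elim face_orderE) blast
    then have j: "j' = j" using fc_rank_eq[of j g j' h] by auto
    consider "i = j" | "j = k" | "i = -1" | "k = 3" | "i = 0" "j = 1" "k = 2"
      using g h j by fastforce
    then show "(x, z) \<in> face_order"
    proof cases
      case 1 then show ?thesis using g h j face_orderI[of j k h] by auto
    next
      case 2 then show ?thesis using g h j face_orderI[of i j g] by auto
    next
      case 3 then show ?thesis using g h j face_orderI[of i k h] fc_improper[of g h i] by auto
    next
      case 4 then show ?thesis using g h j face_orderI[of i k g] fc_improper[of g h k] by auto
    next
      \<comment> \<open>The only genuine case is vertex, edge, 2-face. If the two representatives of
        the edge differ by \<open>t\<close>, then \<open>g \<otimes> c\<close> lies in both the
        vertex and the 2-face.\<close>
      case 5
      then have "h = g \<or> h = g \<otimes> t" using edge_eqD[of g h] g h j by auto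
      then show ?thesis
        using 5 g h face_orderI[of 0 2 g] face_orderI[of 0 2 "g \<otimes> c"] by auto
    qed
  qed
  show ?thesis
    using refl antisym trans face_order_subset by (auto simp: partial_order_on_def preorder_on_def)
qed

text \<open>\<open>flag False g\<close> and \<open>flag True g\<close> run through the two flag orbits.\<close>

definition flag :: "bool \<Rightarrow> 'a \<Rightarrow> 'f set" where
  "flag b g = (\<lambda>i. fc i (if b \<and> i = 2 then g \<otimes> t else g)) ` {-1..3}"

section \<open>Flags as maximal chains\<close>

lemma fc_neq: "i \<noteq> j \<Longrightarrow> i \<in> {-1..3} \<Longrightarrow> j \<in> {-1..3} \<Longrightarrow> g \<in> carrier G \<Longrightarrow> h \<in> carrier G \<Longrightarrow> fc i g \<noteq> fc j h"
  using fc_rank_eq by blast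

lemma flag_expand:
  "flag b g = {fc (-1) g, fc 0 g, fc 1 g, fc 2 (if b then g \<otimes> t else g), fc 3 g}"
proof -
  have "{-1..3::int} = {-1, 0, 1, 2, 3}" by auto
  then show ?thesis by (simp add: flag_def)
qed

lemma card_flag:
  assumes "g \<in> carrier G"
  shows "card (flag b g) = 5"
proof -
  have "inj_on (\<lambda>i. fc i (if b \<and> i = 2 then g \<otimes> t else g)) {-1..3}"
    by (rule inj_onI, erule fc_rank_eq) (use assms in auto)
  then show ?thesis
    by (simp add: flag_def card_image)
qed

lemma finite_flag: "finite (flag b g)"
  by (simp add: flag_def)

lemma flag_chain: 
  assumes g: "g \<in> carrier G"
  shows "flag b g \<in> Chains face_order"
proof -
  \<comment> \<open>The 2-face of \<open>flag True g\<close> is that of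
    \<open>g \<otimes> t\<close>. It shares the element \<open>g \<otimes> c\<close> with the vertex
    and \<open>g \<otimes> t\<close> with the other faces.\<close>
  have "\<exists>h \<in> carrier G. fc i g = fc i h \<and> fc 2 (g \<otimes> t) = fc 2 h" if "i \<in> {-1,0,1,3}" for i
  proof (cases "i = 0")
    case True then show ?thesis using g by (intro bexI[of _ "g \<otimes> c"]) auto
  next
    case False then show ?thesis using g that by (intro bexI[of _ "g \<otimes> t"]) (auto intro: fc_improper)
  qed
  then have "(fc i g, fc 2 (g \<otimes> t)) \<in> face_order" if "i \<in> {-1,0,1}" for i
    using that face_orderI[of i 2] by fastforce
  moreover have "(fc 2 (g \<otimes> t), fc 3 g) \<in> face_order"
    using face_orderI[of 2 3 "g \<otimes> t"] fc_improper[of g "g \<otimes> t" 3] g by auto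
  moreover have "(fc i g, fc j g) \<in> face_order" if "i \<in> {-1,0,1,2,3}" "j \<in> {-1,0,1,2,3}" "i \<le> j" for i j
    using that g by (intro face_orderI) auto
  moreover have "(fc 2 (g \<otimes> t), fc 2 (g \<otimes> t)) \<in> face_order"
    using g by (intro face_orderI) auto
  ultimately show ?thesis
    unfolding Chains_def flag_expand by (cases b) simp_all
qed

lemma chain_same_rank:
  assumes "C \<in> Chains face_order" "fc i g \<in> C" "fc i h \<in> C" "i \<in> {-1..3}" "g \<in> carrier G" "h \<in> carrier G"
  shows "fc i g = fc i h"
proof -
  have "(fc i g, fc i h) \<in> face_order \<or> (fc i h, fc i g) \<in> face_order"
    using assms by (auto simp: Chains_def)
  then show ?thesis using assms face_order_fc_iff by metis
qed

lemma chain_incident: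
  assumes "C \<in> Chains face_order" "fc i g \<in> C" "fc j h \<in> C" "i \<in> {-1..3}" "j \<in> {-1..3}" "g \<in> carrier G" "h \<in> carrier G"
  shows "\<exists>k \<in> carrier G. fc i k = fc i g \<and> fc j k = fc j h"
proof -
  have "(fc i g, fc j h) \<in> face_order \<or> (fc j h, fc i g) \<in> face_order"
    using assms by (auto simp: Chains_def)
  then show ?thesis using assms face_order_fc_iff by metis
qed

text \<open>A chain has at most one face of each rank. Without an edge, a common element of vertex
  and 2-face gives \<open>flag False\<close>. With an edge, the vertex selects one of its two
  elements, and \<open>b\<close> records on which side the 2-face lies.\<close>

lemma chain_subset_flag:
  assumes C: "C \<in> Chains face_order"
  shows "\<exists>b. \<exists>g \<in> carrier G. C \<subseteq> flag b g"
proof -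
  have C_faces: "C \<subseteq> faces"
    using C face_order_subset by (auto simp: Chains_def)
  have sub: "C \<subseteq> flag b g" if g: "g \<in> carrier G"
    and 0: "\<And>h. h \<in> carrier G \<Longrightarrow> fc 0 h \<in> C \<Longrightarrow> fc 0 h = fc 0 g"
    and 1: "\<And>h. h \<in> carrier G \<Longrightarrow> fc 1 h \<in> C \<Longrightarrow> fc 1 h = fc 1 g"
    and 2: "\<And>h. h \<in> carrier G \<Longrightarrow> fc 2 h \<in> C \<Longrightarrow> fc 2 h = fc 2 (if b then g \<otimes> t else g)" for b g
  proof
    fix x assume x: "x \<in> C"
    then obtain i h where h: "i \<in> {-1..3}" "h \<in> carrier G" "x = fc i h"
      using C_faces facesE by blast
    then have "i = -1 \<or> i = 0 \<or> i = 1 \<or> i = 2 \<or> i = 3" by auto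
    then show "x \<in> flag b g"
      using h(2,3) g x 0[of h] 1[of h] 2[of h] fc_improper[of h g i] unfolding flag_expand by safe auto
  qed
  define mem where "mem i = (\<exists>g \<in> carrier G. fc i g \<in> C)" for i :: int
  have same: "fc i h = fc i g" if "fc i g \<in> C" "fc i h \<in> C" "i \<in> {0..2}" "g \<in> carrier G" "h \<in> carrier G" for i g h
    using chain_same_rank[OF C that(2,1)] that by auto
  show ?thesis
  proof (cases "mem 1")
    case False
    have "\<exists>g \<in> carrier G. (\<forall>h \<in> carrier G. fc 0 h \<in> C \<longrightarrow> fc 0 h = fc 0 g) \<and>
                         (\<forall>h \<in> carrier G. fc 2 h \<in> C \<longrightarrow> fc 2 h = fc 2 g)"
    proof (cases "mem 0 \<and> mem 2")
      case True
      then obtain g h where gh: "g \<in> carrier G" "h \<in> carrier G" "fc 0 g \<in> C" "fc 2 h \<in> C"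
        by (auto simp: mem_def)
      then obtain k where k: "k \<in> carrier G" "fc 0 k = fc 0 g" "fc 2 k = fc 2 h"
        using chain_incident[OF C, of 0 g 2 h] by auto
      have "fc 0 h' = fc 0 k" if "h' \<in> carrier G" "fc 0 h' \<in> C" for h'
        using same[OF gh(3) that(2)] that gh k by simp
      moreover have "fc 2 h' = fc 2 k" if "h' \<in> carrier G" "fc 2 h' \<in> C" for h'
        using same[OF gh(4) that(2)] that gh k by simp
      ultimately show ?thesis using k(1) by blast
    next
      case False
      then consider "\<not> mem 0" | "\<not> mem 2" by blast
      then show ?thesis
      proof cases
        case 1
        have "\<exists>g \<in> carrier G. \<forall>h \<in> carrier G. fc 2 h \<in> C \<longrightarrow> fc 2 h = fc 2 g"
          using same[of 2] one_closed by (metis atLeastAtMost_iff order_refl zero_le_numeral)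
        then show ?thesis using 1 unfolding mem_def by blast
      next
        case 2
        have "\<exists>g \<in> carrier G. \<forall>h \<in> carrier G. fc 0 h \<in> C \<longrightarrow> fc 0 h = fc 0 g"
          using same[of 0] one_closed by (metis atLeastAtMost_iff order_refl zero_le_numeral)
        then show ?thesis using 2 unfolding mem_def by blast
      qed
    qed
    then obtain g where "g \<in> carrier G" "\<forall>h \<in> carrier G. fc 0 h \<in> C \<longrightarrow> fc 0 h = fc 0 g"
      "\<forall>h \<in> carrier G. fc 2 h \<in> C \<longrightarrow> fc 2 h = fc 2 g" by blast
    then show ?thesis using sub[of g False] False unfolding mem_def by auto
  next
    case True
    then obtain g0 where g0: "g0 \<in> carrier G" "fc 1 g0 \<in> C" by (auto simp: mem_def)
    have "\<exists>g \<in> carrier G. fc 1 g = fc 1 g0 \<and> (\<forall>h \<in> carrier G. fc 0 h \<in> C \<longrightarrow> fc 0 h = fc 0 g)"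
    proof (cases "mem 0")
      case True
      then obtain h where h: "h \<in> carrier G" "fc 0 h \<in> C" by (auto simp: mem_def)
      then obtain k where k: "k \<in> carrier G" "fc 0 k = fc 0 h" "fc 1 k = fc 1 g0"
        using chain_incident[OF C, of 0 h 1 g0] g0 by auto
      have "fc 0 h' = fc 0 k" if "h' \<in> carrier G" "fc 0 h' \<in> C" for h'
        using same[OF h(2) that(2)] that h k by simp
      then show ?thesis using k by blast
    next
      case False
      then show ?thesis using g0 by (auto simp: mem_def)
    qed
    then obtain g where g: "g \<in> carrier G" "fc 1 g = fc 1 g0"
      and v: "\<And>h. h \<in> carrier G \<Longrightarrow> fc 0 h \<in> C \<Longrightarrow> fc 0 h = fc 0 g" by blast
    have e: "\<And>h. h \<in> carrier G \<Longrightarrow> fc 1 h \<in> C \<Longrightarrow> fc 1 h = fc 1 g"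
      using same[OF g0(2)] g g0 by simp
    have "\<exists>b. \<forall>h \<in> carrier G. fc 2 h \<in> C \<longrightarrow> fc 2 h = fc 2 (if b then g \<otimes> t else g)"
    proof (cases "mem 2")
      case True
      then obtain h where h: "h \<in> carrier G" "fc 2 h \<in> C" by (auto simp: mem_def)
      then obtain k where k: "k \<in> carrier G" "fc 1 k = fc 1 g0" "fc 2 k = fc 2 h"
        using chain_incident[OF C, of 1 g0 2 h] g0 by auto
      then have "k = g \<or> k = g \<otimes> t" using edge_eqD[of g k] g by auto
      then obtain b where "fc 2 h = fc 2 (if b then g \<otimes> t else g)"
        using k by (cases "k = g") (auto intro: that[of False] that[of True])
      then have "fc 2 h' = fc 2 (if b then g \<otimes> t else g)" if "h' \<in> carrier G" "fc 2 h' \<in> C" for h'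
        using same[OF h(2) that(2)] that h by simp
      then show ?thesis by blast
    next
      case False
      then show ?thesis by (auto simp: mem_def)
    qed
    then obtain b where "\<And>h. h \<in> carrier G \<Longrightarrow> fc 2 h \<in> C \<Longrightarrow> fc 2 h = fc 2 (if b then g \<otimes> t else g)"
      by blast
    then show ?thesis using sub[OF g(1) v e] g(1) by blast
  qed
qed

text \<open>Every chain lies in some \<open>flag b g\<close>, and all of these have five elements,
  so they are exactly the maximal chains.\<close>

lemma flags_eq: "flags face_order = {flag b g | b g. g \<in> carrier G}"
proof (intro equalityI subsetI)
  fix C assume C: "C \<in> flags face_order"
  then obtain b g where "g \<in> carrier G" "C \<subseteq> flag b g"
    using chain_subset_flag[of C] by (auto simp: flags_def)
  then show "C \<in> {flag b g | b g. g \<in> carrier G}"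
    using C flag_chain[of g b] by (auto simp: flags_def)
next
  fix C assume "C \<in> {flag b g | b g. g \<in> carrier G}"
  then obtain b g where g: "g \<in> carrier G" "C = flag b g" by blast
  have "D = C" if D: "D \<in> Chains face_order" "C \<subseteq> D" for D
  proof -
    obtain b' h where h: "h \<in> carrier G" "D \<subseteq> flag b' h"
      using chain_subset_flag[OF D(1)] by blast
    then have "C \<subseteq> flag b' h" using D by blast
    then have "C = flag b' h"
      using card_flag[of g b] card_flag[of h b'] g h card_subset_eq[OF finite_flag] by metis
    then show ?thesis using D h by blast
  qed
  then show "C \<in> flags face_order"
    using flag_chain[of g b] g by (auto simp: flags_def)
qed

lemma fc_in_flag_iff:
  assumes "g \<in> carrier G" "h \<in> carrier G" "i \<in> {-1..3}"
  shows "fc i h \<in> flag b g \<longleftrightarrow> fc i h = fc i (if b \<and> i = 2 then g \<otimes> t else g)"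
proof -
  have "i = j" if "fc i h = fc j (if b \<and> j = 2 then g \<otimes> t else g)" "j \<in> {-1..3}" for j
    using fc_rank_eq[OF that(1)] that(2) assms by auto
  then show ?thesis
    using assms unfolding flag_def by blast
qed

end

section \<open>Adjacency and connectivity of flags\<close>

context coset_geometry
begin

abbreviation flag_face :: "bool \<Rightarrow> 'a \<Rightarrow> int \<Rightarrow> 'f" where
  "flag_face b g i \<equiv> fc i (if b \<and> i = 2 then g \<otimes> t else g)"

lemma flag_face_eqD:
  "flag_face b g i = flag_face b' h j \<Longrightarrow> i \<in> {-1..3} \<Longrightarrow> j \<in> {-1..3} \<Longrightarrow> g \<in> carrier G \<Longrightarrow>
    h \<in> carrier G \<Longrightarrow> i = j"
  by (erule fc_rank_eq) auto

lemma flag_face_in_iff: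
  "g \<in> carrier G \<Longrightarrow> h \<in> carrier G \<Longrightarrow> i \<in> {-1..3} \<Longrightarrow>
    flag_face b h i \<in> flag b' g \<longleftrightarrow> flag_face b h i = flag_face b' g i"
  using fc_in_flag_iff[of g "if b \<and> i = 2 then h \<otimes> t else h" i b'] by simp

lemma flag_in_flags [simp, intro]: "g \<in> carrier G \<Longrightarrow> flag b g \<in> flags face_order"
  unfolding flags_eq by blast

lemma card_flag_diff:
  assumes "g \<in> carrier G" "h \<in> carrier G"
  shows "card (flag b g - flag b' h) = card {i \<in> {-1..3}. flag_face b g i \<noteq> flag_face b' h i}"
proof -
  have "flag b g - flag b' h = flag_face b g ` {i \<in> {-1..3}. flag_face b g i \<noteq> flag_face b' h i}"
    using flag_face_in_iff[OF assms(2,1)] unfolding flag_def[of b g] by blast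
  moreover have "inj_on (flag_face b g) {i \<in> {-1..3}. flag_face b g i \<noteq> flag_face b' h i}"
    using flag_face_eqD[where b=b and b'=b and g=g and h=g] assms(1) unfolding inj_on_def by blast
  ultimately show ?thesis by (simp add: card_image)
qed

lemma adjacent_flags_iff:
  assumes "g \<in> carrier G" "h \<in> carrier G"
  shows "adjacent_flags face_order (flag b g) (flag b' h) \<longleftrightarrow>
    card {i \<in> {-1..3}. flag_face b g i \<noteq> flag_face b' h i} = 1"
proof -
  have "{i \<in> {-1..3}. flag_face b' h i \<noteq> flag_face b g i} =
        {i \<in> {-1..3}. flag_face b g i \<noteq> flag_face b' h i}"
    by (intro Collect_cong conj_cong refl arg_cong[where f = Not] eq_commute)
  then show ?thesis
    using card_flag_diff[OF assms, of b b'] card_flag_diff[OF assms(2,1), of b' b]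
      flag_in_flags assms unfolding adjacent_flags_def by presburger
qed

lemma flag_face_improper:
  "g \<in> carrier G \<Longrightarrow> h \<in> carrier G \<Longrightarrow> i \<in> {-1, 3} \<Longrightarrow> flag_face b g i = flag_face b' h i"
  by (rule fc_improper) auto

lemma adjacent_flagsI:
  assumes g: "g \<in> carrier G" and h: "h \<in> carrier G" and "i \<in> {0, 1, 2}"
    and "\<And>j. j \<in> {0, 1, 2} \<Longrightarrow> j \<noteq> i \<Longrightarrow> flag_face b g j = flag_face b' h j"
    and "flag_face b g i \<noteq> flag_face b' h i"
  shows "adjacent_flags face_order (flag b g) (flag b' h)"
proof -
  have "flag_face b g j = flag_face b' h j" if "j \<in> {-1..3}" "j \<noteq> i" for j
  proof (cases "j \<in> {0, 1, 2}")
    case False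
    then have "j \<in> {-1, 3}" using that by auto
    then show ?thesis using flag_face_improper[OF g h] by blast
  qed (use assms that in blast)
  then have "{i \<in> {-1..3}. flag_face b g i \<noteq> flag_face b' h i} = {i}"
    using assms(3,5) by fastforce
  then show ?thesis using adjacent_flags_iff[OF g h] by simp
qed

lemma adjacent_flags_sym: "adjacent_flags r A B \<Longrightarrow> adjacent_flags r B A"
  by (auto simp: adjacent_flags_def)

lemma fc_0_t_neq: "g \<in> carrier G \<Longrightarrow> fc 0 (g \<otimes> t) \<noteq> fc 0 g"
  using fc_mult_eq_iff[of 0 g t] t_notin_stabilizer_0 by simp

lemma fc_1_inv_c_neq: "g \<in> carrier G \<Longrightarrow> fc 1 (g \<otimes> inv c) \<noteq> fc 1 g"
  using fc_mult_eq_iff[of 1 g "inv c"] inv_c_notin_stabilizer_1 by simp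

lemma fc_2_t_neq: "g \<in> carrier G \<Longrightarrow> fc 2 (g \<otimes> t) \<noteq> fc 2 g"
  using fc_mult_eq_iff[of 2 g t] t_notin_stabilizer_2 by simp

text \<open>This and the next two lemmas give the \<open>i\<close>-adjacent flags of
  \<open>flag False g\<close> explicitly; all three belong to the other family.\<close>

lemma adjacent_0: "g \<in> carrier G \<Longrightarrow> adjacent_flags face_order (flag False g) (flag True (g \<otimes> t))"
  using fc_0_t_neq[of g] by (intro adjacent_flagsI[of _ _ 0]) auto

lemma adjacent_1: "g \<in> carrier G \<Longrightarrow> adjacent_flags face_order (flag False g) (flag True (g \<otimes> inv c))"
  using fc_1_inv_c_neq[of g] by (intro adjacent_flagsI[of _ _ 1]) auto

lemma adjacent_2: "g \<in> carrier G \<Longrightarrow> adjacent_flags face_order (flag False g) (flag True g)"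
  using fc_2_t_neq[of g] by (intro adjacent_flagsI[of _ _ 2]) auto

lemma flag_faces_meet:
  assumes g: "g \<in> carrier G" and h: "h \<in> carrier G" and ij: "i \<in> {0..2}" "j \<in> {0..2}" "i < j"
    and eq: "flag_face b g i = flag_face b h i" "flag_face b g j = flag_face b h j"
  shows "g = h"
proof (cases "b \<and> j = 2")
  case False
  then show ?thesis using fc_meet[of i j g h] assms by auto
next
  \<comment> \<open>Right multiplication by \<open>c\<close> keeps the vertex, by \<open>t\<close>
    the edge, and both turn the 2-face of \<open>g\<close> into that of
    \<open>g \<otimes> t\<close>. So \<open>fc_meet\<close> applies to the shifted elements.\<close>
  case True
  then consider "i = 0" | "i = 1" using ij by fastforce
  then show ?thesis
  proof cases
    case 1
    then have "g \<otimes> c = h \<otimes> c" using fc_meet[of 0 2 "g \<otimes> c" "h \<otimes> c"] eq g h True by simp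
    then show ?thesis using g h by simp
  next
    case 2
    then have "g \<otimes> t = h \<otimes> t" using fc_meet[of 1 2 "g \<otimes> t" "h \<otimes> t"] eq g h True by simp
    then show ?thesis using g h by simp
  qed
qed

text \<open>Adjacent flags share at least two proper faces, and within one family two such faces
  already determine the group element.\<close>

lemma adjacent_flags_alternate:
  assumes g: "g \<in> carrier G" and h: "h \<in> carrier G"
    and adj: "adjacent_flags face_order (flag b g) (flag b' h)"
  shows "b \<noteq> b'"
proof
  assume b: "b = b'"
  have "card {j \<in> {-1..3}. flag_face b g j \<noteq> flag_face b h j} = 1"
    using adj unfolding b[symmetric] adjacent_flags_iff[OF g h] .
  then obtain i where i: "{j \<in> {-1..3}. flag_face b g j \<noteq> flag_face b h j} = {i}"
    by (rule card_1_singletonE)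
  then have eq: "flag_face b g j = flag_face b h j" if "j \<in> {-1..3}" "j \<noteq> i" for j
    using that by blast
  have "g = h"
  proof (cases "i = 0")
    case True
    then show ?thesis using eq[of 1] eq[of 2] flag_faces_meet[OF g h, of 1 2 b] by simp
  next
    case False
    show ?thesis
    proof (cases "i = 1")
      case True
      then show ?thesis using eq[of 0] eq[of 2] flag_faces_meet[OF g h, of 0 2 b] by simp
    next
      case 1: False
      then show ?thesis using False eq[of 0] eq[of 1] flag_faces_meet[OF g h, of 0 1 b] by simp
    qed
  qed
  then show False using i by blast
qed

section \<open>Connectivity of the flags through a common face\<close>

definition link :: "'f \<Rightarrow> ('f set \<times> 'f set) set" where
  "link x = {(A, B). adjacent_flags face_order A B \<and> x \<in> A \<and> x \<in> B}"

lemma sym_link: "sym ((link x)\<^sup>*)"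
  by (rule sym_rtrancl) (auto simp: sym_def link_def intro: adjacent_flags_sym)

text \<open>The elements \<open>x\<close> that work for all \<open>g\<close> at once form a subgroup
  \<open>H\<close>, since paths can be translated and concatenated. It contains the generators of
  the stabilizer, each of which amounts to two adjacency steps.\<close>

lemma link_connected_stabilizer:
  assumes i: "i \<in> {-1..3}" and x: "x \<in> face_stabilizer i" and g: "g \<in> carrier G"
  shows "(flag False g, flag False (g \<otimes> x)) \<in> (link (fc i g))\<^sup>*"
proof -
  define H where "H = {x \<in> face_stabilizer i. \<forall>g \<in> carrier G.
    (flag False g, flag False (g \<otimes> x)) \<in> (link (fc i g))\<^sup>*}"
  have HG: "y \<in> carrier G" if "y \<in> H" for y
    using that stabilizer_subset unfolding H_def by blast
  have "subgroup H G"
  proof (rule subgroupI)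
    show "H \<subseteq> carrier G" using HG by blast
    show "H \<noteq> {}" by (auto simp: H_def intro!: exI[of _ \<one>])
    fix y assume y: "y \<in> H"
    have "(flag False k, flag False (k \<otimes> inv y)) \<in> (link (fc i k))\<^sup>*" if k: "k \<in> carrier G" for k
    proof -
      have "inv y \<in> face_stabilizer i"
        using y subgroup.m_inv_closed[OF subgroup_stabilizer] by (auto simp: H_def)
      then have "fc i (k \<otimes> inv y) = fc i k" using fc_eqI[OF i k] by simp
      moreover have "(flag False (k \<otimes> inv y), flag False (k \<otimes> inv y \<otimes> y)) \<in> (link (fc i (k \<otimes> inv y)))\<^sup>*"
        using y k HG[OF y] by (simp add: H_def)
      ultimately show ?thesis
        using k HG[OF y] sym_link[of "fc i k"] by (simp add: m_assoc symD)
    qed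
    then show "inv y \<in> H" using y subgroup.m_inv_closed[OF subgroup_stabilizer]
      by (auto simp: H_def)
    fix z assume z: "z \<in> H"
    have "(flag False k, flag False (k \<otimes> (y \<otimes> z))) \<in> (link (fc i k))\<^sup>*" if k: "k \<in> carrier G" for k
    proof -
      have "fc i (k \<otimes> y) = fc i k" using fc_eqI[OF i k] y by (simp add: H_def)
      then have "(flag False (k \<otimes> y), flag False (k \<otimes> y \<otimes> z)) \<in> (link (fc i k))\<^sup>*"
        using bspec[OF conjunct2[OF CollectD[OF z[unfolded H_def]]], of "k \<otimes> y"] k HG[OF y] by simp
      moreover have "(flag False k, flag False (k \<otimes> y)) \<in> (link (fc i k))\<^sup>*"
        using y k by (simp add: H_def)
      ultimately show ?thesis
        using k HG[OF y] HG[OF z] by (simp add: m_assoc)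
    qed
    then show "y \<otimes> z \<in> H" using y z subgroup.m_closed[OF subgroup_stabilizer]
      by (auto simp: H_def)
  qed
  \<comment> \<open>The intermediate flag of the other family must also contain the common
    face.\<close>
  have two_steps: "(flag False k, flag False l) \<in> (link (fc i k))\<^sup>*"
    if "adjacent_flags face_order (flag False k) (flag True m)"
      "adjacent_flags face_order (flag False l) (flag True m)"
      "k \<in> carrier G" "l \<in> carrier G" "m \<in> carrier G"
      "fc i l = fc i k" "flag_face True m i = fc i k" for k l m
  proof -
    have "fc i k \<in> flag False k" "fc i k \<in> flag False l" "fc i k \<in> flag True m"
      using that i by (simp_all add: fc_in_flag_iff)
    then have "(flag False k, flag True m) \<in> link (fc i k)" "(flag True m, flag False l) \<in> link (fc i k)"
      using that adjacent_flags_sym by (auto simp: link_def)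
    then show ?thesis by auto
  qed
  \<comment> \<open>The paths for \<open>t\<close>, \<open>inv c\<close> and
    \<open>inv c \<otimes> t\<close> change the ranks 2 and 0, 1 and 2, and 1 and 0 respectively, so
    the face of the remaining rank is kept.\<close>
  have t: "t \<in> H" if "i \<in> {-1, 1, 3}"
  proof -
    have "t \<in> face_stabilizer i" using that by (auto simp: face_stabilizer_def)
    moreover have "(flag False k, flag False (k \<otimes> t)) \<in> (link (fc i k))\<^sup>*" if k: "k \<in> carrier G" for k
      using adjacent_2[OF k] adjacent_0[of "k \<otimes> t"] fc_eqI[OF i k \<open>t \<in> face_stabilizer i\<close>] k \<open>i \<in> {-1, 1, 3}\<close>
      by (intro two_steps[of k k]) auto
    ultimately show ?thesis by (simp add: H_def)
  qed
  have c: "inv c \<in> H" if "i \<in> {-1, 0, 3}"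
  proof -
    have "inv c \<in> face_stabilizer i"
      using that subgroup.m_inv_closed[OF subgroup_stabilizer c_stabilizer] by (auto simp: face_stabilizer_def)
    moreover have "(flag False k, flag False (k \<otimes> inv c)) \<in> (link (fc i k))\<^sup>*" if k: "k \<in> carrier G" for k
      using adjacent_1[OF k] adjacent_2[of "k \<otimes> inv c"] fc_eqI[OF i k \<open>inv c \<in> face_stabilizer i\<close>] k \<open>i \<in> {-1, 0, 3}\<close>
      by (intro two_steps[of k "k \<otimes> inv c"]) auto
    ultimately show ?thesis by (simp add: H_def)
  qed
  have ct: "inv c \<otimes> t \<in> H" if "i = 2"
  proof -
    have "inv (t \<otimes> c) \<in> face_stabilizer i"
      using that tc_stabilizer subgroup.m_inv_closed[OF subgroup_stabilizer] by auto
    then have "inv c \<otimes> t \<in> face_stabilizer i"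
      by (simp add: inv_mult_group)
    moreover have "(flag False k, flag False (k \<otimes> (inv c \<otimes> t))) \<in> (link (fc i k))\<^sup>*" if k: "k \<in> carrier G" for k
      using adjacent_1[OF k] adjacent_0[of "k \<otimes> inv c \<otimes> t"] k \<open>i = 2\<close>
      by (intro two_steps[of k "k \<otimes> inv c"]) (auto simp: m_assoc[symmetric])
    ultimately show ?thesis by (simp add: H_def)
  qed
  have inv_H: "y \<in> H" if "inv y \<in> H" "y \<in> carrier G" for y
    using subgroup.m_inv_closed[OF \<open>subgroup H G\<close> that(1)] that by simp
  have "face_stabilizer i \<subseteq> H"
  proof -
    consider "i \<in> {-1, 3}" | "i = 0" | "i = 1" | "i = 2" using i by fastforce
    then show ?thesis
    proof cases
      case 1
      then have "generate G {t, c} \<subseteq> H"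
        using t inv_H[OF c] \<open>subgroup H G\<close> by (intro generate_subgroup_incl) auto
      then show ?thesis using 1 generators by (auto simp: face_stabilizer_def)
    next
      case 2
      then have "generate G {c} \<subseteq> H"
        using inv_H[OF c] \<open>subgroup H G\<close> by (intro generate_subgroup_incl) auto
      then show ?thesis using 2 by (auto simp: face_stabilizer_def)
    next
      case 3
      then show ?thesis using t subgroup.one_closed[OF \<open>subgroup H G\<close>] by (auto simp: face_stabilizer_def)
    next
      case 4
      then have "generate G {t \<otimes> c} \<subseteq> H"
        using inv_H[of "t \<otimes> c"] ct \<open>subgroup H G\<close> by (intro generate_subgroup_incl) (auto simp: inv_mult_group)
      then show ?thesis using 4 by (auto simp: face_stabilizer_def)
    qed
  qed
  then show ?thesis using x g by (auto simp: H_def)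
qed

lemma link_connected:
  assumes i: "i \<in> {-1..3}" and g: "g \<in> carrier G" and h: "h \<in> carrier G"
    and eq: "flag_face b g i = flag_face b' h i"
  shows "(flag b g, flag b' h) \<in> (link (flag_face b g i))\<^sup>*"
proof -
  have straighten: "\<exists>k \<in> carrier G. fc i k = flag_face b g i \<and> (flag b g, flag False k) \<in> (link (flag_face b g i))\<^sup>*"
    if g: "g \<in> carrier G" for b g
  proof (cases b)
    case False
    then show ?thesis using g by auto
  next
    case True
    \<comment> \<open>A flag of the second family is first moved to its 2-adjacent flag, or to its
      0-adjacent flag if the face to be kept is the 2-face.\<close>
    define k where "k = (if i = 2 then g \<otimes> t else g)"
    have k: "k \<in> carrier G" using g by (simp add: k_def)
    have "adjacent_flags face_order (flag False k) (flag True g)"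
      using adjacent_2[OF g] adjacent_0[of "g \<otimes> t"] g by (auto simp: k_def)
    moreover have "fc i k \<in> flag False k" "fc i k \<in> flag True g"
      using g k i by (auto simp: fc_in_flag_iff k_def)
    ultimately have "(flag True g, flag False k) \<in> (link (fc i k))\<^sup>*"
      using adjacent_flags_sym by (auto simp: link_def)
    then show ?thesis using True k by (auto simp: k_def)
  qed
  obtain k where k: "k \<in> carrier G" "fc i k = flag_face b g i"
    "(flag b g, flag False k) \<in> (link (flag_face b g i))\<^sup>*" using straighten[OF g] by blast
  obtain l where l: "l \<in> carrier G" "fc i l = flag_face b' h i"
    "(flag b' h, flag False l) \<in> (link (flag_face b' h i))\<^sup>*" using straighten[OF h] by blast
  obtain x where "x \<in> face_stabilizer i" "l = k \<otimes> x"
    using fc_eqE[OF i k(1) l(1)] k(2) l(2) eq by metis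
  then have "(flag False k, flag False l) \<in> (link (flag_face b g i))\<^sup>*"
    using link_connected_stabilizer[OF i _ k(1)] k(2) by simp
  moreover have "(flag False l, flag b' h) \<in> (link (flag_face b g i))\<^sup>*"
    using l(3) eq sym_link by (metis symD)
  ultimately show ?thesis using k(3) by (meson rtrancl_trans)
qed

text \<open>If at most one proper face is shared, a path inside its link contains the whole
  intersection. If two are shared, the flags are equal or adjacent.\<close>

lemma flags_strongly_connected:
  assumes "A \<in> flags face_order" "B \<in> flags face_order"
  shows "\<exists>(k::nat) s. s 0 = A \<and> s k = B \<and> (\<forall>i\<le>k. s i \<in> flags face_order \<and> A \<inter> B \<subseteq> s i) \<and>
    (\<forall>i<k. adjacent_flags face_order (s i) (s (Suc i)))"
proof -
  obtain b g b' h where g: "g \<in> carrier G" "A = flag b g" and h: "h \<in> carrier G" "B = flag b' h"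
    using assms unfolding flags_eq by blast
  define E where "E = {i \<in> {0, 1, 2}. flag_face b g i = flag_face b' h i}"
  show ?thesis
  proof (cases "\<exists>i. E \<subseteq> {i}")
    case True
    then obtain i where i: "i \<in> {-1..3}" "E \<subseteq> {i}" "flag_face b g i = flag_face b' h i"
    proof (cases "E = {}")
      \<comment> \<open>Without a shared proper face the least face is used; it lies in every flag,
        so its link imposes no restriction.\<close>
      case True
      then show ?thesis using that[of "-1"] fc_improper[OF g(1) h(1), of "-1"] by auto
    next
      case False
      then obtain i where "E = {i}" using \<open>\<exists>i. E \<subseteq> {i}\<close> by blast
      then have "i \<in> E" by simp
      then have "i \<in> {0, 1, 2}" "flag_face b g i = flag_face b' h i" unfolding E_def by blast+
      then show ?thesis using that[of i] \<open>E = {i}\<close> by auto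
    qed
    then have "(A, B) \<in> (link (flag_face b g i))\<^sup>*"
      using link_connected g h by blast
    then obtain k where "(A, B) \<in> link (flag_face b g i) ^^ k"
      using rtrancl_imp_relpow by blast
    then obtain s where s: "s 0 = A" "s k = B" "\<And>j. j < k \<Longrightarrow> (s j, s (Suc j)) \<in> link (flag_face b g i)"
      using relpow_fun_conv by metis
    have mem: "s j \<in> flags face_order \<and> flag_face b g i \<in> s j" if "j \<le> k" for j
    proof (cases "j = k")
      case True
      then show ?thesis using s(2) assms(2) i h g
        by (simp add: fc_in_flag_iff)
    next
      case False
      then have "(s j, s (Suc j)) \<in> link (flag_face b g i)" using that s(3) by simp
      then show ?thesis by (simp add: link_def adjacent_flags_def)
    qed
    have "A \<inter> B \<subseteq> s j" if j: "j \<le> k" for j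
    proof
      fix x assume "x \<in> A \<inter> B"
      then obtain l where l: "l \<in> {-1..3}" "x = flag_face b g l" "flag_face b g l \<in> flag b' h"
        using g h unfolding flag_def by blast
      then have "flag_face b g l = flag_face b' h l"
        using flag_face_in_iff[OF h(1) g(1)] by blast
      then have "l = -1 \<or> l = 3 \<or> l \<in> E" using l(1) by (auto simp: E_def)
      then have "l \<in> {-1, 3} \<or> l = i" using i(2) by auto
      moreover obtain b2 k2 where k: "k2 \<in> carrier G" "s j = flag b2 k2"
        using mem[OF j] unfolding flags_eq by blast
      moreover have "flag_face b g l = flag_face b2 k2 l" if "l \<in> {-1, 3}"
        by (rule flag_face_improper[OF g(1) k(1) that])
      ultimately show "x \<in> s j"
        using l(1,2) flag_face_in_iff[OF k(1) g(1) l(1)] mem[OF j] by metis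
    qed
    then show ?thesis using s mem by (intro exI[of _ k] exI[of _ s]) (auto simp: link_def)
  next
    case False
    have "\<exists>i \<in> {0, 1, 2}. E \<supseteq> {0, 1, 2} - {i}"
    proof (rule ccontr)
      assume "\<not> ?thesis"
      moreover have "\<And>x. x \<in> E \<Longrightarrow> x = 0 \<or> x = 1 \<or> x = 2" unfolding E_def by blast
      ultimately have "E \<subseteq> {0} \<or> E \<subseteq> {1} \<or> E \<subseteq> {2}" by auto
      then show False using False by blast
    qed
    then obtain i where i: "i \<in> {0, 1, 2}" "\<And>j. j \<in> {0, 1, 2} \<Longrightarrow> j \<noteq> i \<Longrightarrow> flag_face b g j = flag_face b' h j"
      unfolding E_def by blast
    show ?thesis
    proof (cases "flag_face b g i = flag_face b' h i")
      case True
      have eq: "flag_face b g j = flag_face b' h j" if "j \<in> {-1..3}" for j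
      proof (cases "j \<in> {0, 1, 2}")
        case False
        then have "j \<in> {-1, 3}" using that by auto
        then show ?thesis using flag_face_improper[OF g(1) h(1)] by blast
      next
        case jm: True
        show ?thesis
        proof (cases "j = i")
          case False
          then show ?thesis by (rule i(2)[OF jm])
        qed (use \<open>flag_face b g i = flag_face b' h i\<close> in blast)
      qed
      have "A = B" unfolding g h flag_def by (rule image_cong[OF refl eq])
      then show ?thesis using assms by (intro exI[of _ 0] exI[of _ "\<lambda>_. A"]) auto
    next
      case False
      then have "adjacent_flags face_order A B" using adjacent_flagsI[OF g(1) h(1) i] g h by blast
      then show ?thesis using assms
        by (intro exI[of _ "1::nat"] exI[of _ "\<lambda>j. if j = 0 then A else B"]) auto
    qed
  qed
qed

section \<open>The diamond condition and the remaining polyhedron axioms\<close>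

lemma face_rank_range: "face_rank ` faces = {-1..3}"
proof
  show "{-1..3} \<subseteq> face_rank ` faces"
  proof
    fix i :: int assume "i \<in> {-1..3}"
    then have "i = face_rank (fc i \<one>)" "fc i \<one> \<in> faces" by auto
    then show "i \<in> face_rank ` faces" by blast
  qed
qed (auto elim!: facesE)

lemma diamond_condition:
  assumes i: "i \<in> {0..2}" and FG: "(F, K) \<in> face_order" "face_rank F = i - 1" "face_rank K = i + 1"
  shows "card {H \<in> faces. face_rank H = i \<and> (F, H) \<in> face_order \<and> F \<noteq> H \<and> (H, K) \<in> face_order \<and> H \<noteq> K} = 2"
proof -
  obtain j k g where "-1 \<le> j" "j \<le> k" "k \<le> 3" and g: "g \<in> carrier G" "F = fc j g" "K = fc k g"
    using FG(1) by (rule face_orderE)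
  then have F: "F = fc (i - 1) g" and K: "K = fc (i + 1) g" using FG by auto
  let ?S = "{H \<in> faces. face_rank H = i \<and> (F, H) \<in> face_order \<and> F \<noteq> H \<and> (H, K) \<in> face_order \<and> H \<noteq> K}"
  have S_iff: "H \<in> ?S \<longleftrightarrow> face_rank H = i \<and> (F, H) \<in> face_order \<and> (H, K) \<in> face_order" for H
    using FG face_order_subset by auto
  \<comment> \<open>\<open>h\<close> represents the second face of rank \<open>i\<close> between
    \<open>F\<close> and \<open>K\<close>: the other edge at the corner, or the other vertex or
    2-face of the edge.\<close>
  define h where "h = (if i = 1 then g \<otimes> inv c else g \<otimes> t)"
  have h: "h \<in> carrier G" using g by (simp add: h_def)
  consider "i = 0" | "i = 1" | "i = 2" using i by fastforce
  then have S: "?S = {fc i g, fc i h} \<and> fc i h \<noteq> fc i g"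
  proof cases
    case 1
    then have "(fc (-1) g, fc 0 (g \<otimes> t)) \<in> face_order" "(fc 0 (g \<otimes> t), fc 1 g) \<in> face_order"
      using face_orderI[of "-1" 0 "g \<otimes> t"] face_orderI[of 0 1 "g \<otimes> t"] fc_improper[of g "g \<otimes> t" "-1"] g by auto
    then show ?thesis using 1 F K g vertices_of_edge[of g] fc_0_t_neq[of g]
      unfolding set_eq_iff S_iff by (auto simp: h_def intro: face_orderI)
  next
    case 2
    then have "(fc 0 g, fc 1 (g \<otimes> inv c)) \<in> face_order" "(fc 1 (g \<otimes> inv c), fc 2 g) \<in> face_order"
      using face_orderI[of 0 1 "g \<otimes> inv c"] face_orderI[of 1 2 "g \<otimes> inv c \<otimes> t"] g by auto
    then show ?thesis using 2 F K g edges_at_corner[of g] fc_1_inv_c_neq[of g]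
      unfolding set_eq_iff S_iff by (auto simp: h_def intro: face_orderI)
  next
    case 3
    then have "(fc 1 g, fc 2 (g \<otimes> t)) \<in> face_order" "(fc 2 (g \<otimes> t), fc 3 g) \<in> face_order"
      using face_orderI[of 1 2 "g \<otimes> t"] face_orderI[of 2 3 "g \<otimes> t"] fc_improper[of g "g \<otimes> t" 3] g by auto
    then show ?thesis using 3 F K g faces_of_edge[of g] fc_2_t_neq[of g]
      unfolding set_eq_iff S_iff by (auto simp: h_def intro: face_orderI)
  qed
  show ?thesis
    unfolding conjunct1[OF S] using conjunct2[OF S, symmetric] by simp
qed

lemma abstract_polyhedron_faces: "abstract_polyhedron faces face_order face_rank"
proof
  show "partial_order_on faces face_order" by (rule partial_order_faces)
  show "face_rank ` faces = {-1..3}" by (rule face_rank_range)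
  show "\<exists>F\<in>faces. \<forall>x\<in>faces. (F, x) \<in> face_order"
  proof (intro bexI[of _ "fc (-1) \<one>"] ballI)
    fix x assume "x \<in> faces"
    then obtain i g where "i \<in> {-1..3}" "g \<in> carrier G" "x = fc i g" by (rule facesE)
    then show "(fc (-1) \<one>, x) \<in> face_order"
      using face_orderI[of "-1" i g] fc_improper[of \<one> g "-1"] by auto
  qed auto
  show "\<exists>F\<in>faces. \<forall>x\<in>faces. (x, F) \<in> face_order"
  proof (intro bexI[of _ "fc 3 \<one>"] ballI)
    fix x assume "x \<in> faces"
    then obtain i g where "i \<in> {-1..3}" "g \<in> carrier G" "x = fc i g" by (rule facesE)
    then show "(x, fc 3 \<one>) \<in> face_order"
      using face_orderI[of i 3 g] fc_improper[of \<one> g 3] by auto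
  qed auto
next
  fix x y assume "(x, y) \<in> face_order" "x \<noteq> y"
  then show "face_rank x < face_rank y"
    by (elim face_orderE) (auto simp: order_less_le)
next
  fix C assume "C \<in> flags face_order"
  then show "card C = 5" unfolding flags_eq using card_flag by blast
qed (use flags_strongly_connected diamond_condition in auto)

end

section \<open>Automorphisms and flag orbits\<close>

context coset_geometry
begin

abbreviation face_aut :: "('f \<Rightarrow> 'f) monoid" where
  "face_aut \<equiv> poset_aut faces face_order"

lemma carrier_face_aut:
  "carrier face_aut =
    {f \<in> Bij faces. \<forall>x \<in> faces. \<forall>y \<in> faces. (x, y) \<in> face_order \<longleftrightarrow> (f x, f y) \<in> face_order}"
  by (simp add: poset_aut_def)

lemma face_aut_order_iff:
  "f \<in> carrier face_aut \<Longrightarrow> x \<in> faces \<Longrightarrow> y \<in> faces \<Longrightarrow> (f x, f y) \<in> face_order \<longleftrightarrow> (x, y) \<in> face_order"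
  by (auto simp: carrier_face_aut)

lemma face_aut_closed: "f \<in> carrier face_aut \<Longrightarrow> x \<in> faces \<Longrightarrow> f x \<in> faces"
  using Bij_imp_funcset by (auto simp: carrier_face_aut)

lemma face_aut_eq_iff:
  "f \<in> carrier face_aut \<Longrightarrow> x \<in> faces \<Longrightarrow> y \<in> faces \<Longrightarrow> f x = f y \<longleftrightarrow> x = y"
  by (auto simp: carrier_face_aut Bij_def bij_betw_def dest: inj_onD)

text \<open>The image of the chain through \<open>x\<close> has strictly increasing ranks, and only
  five ranks are available for five faces.\<close>

lemma face_aut_rank:
  assumes f: "f \<in> carrier face_aut" and x: "x \<in> faces"
  shows "face_rank (f x) = face_rank x"
proof -
  obtain i g where g: "i \<in> {-1..3}" "g \<in> carrier G" "x = fc i g"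
    using x by (rule facesE)
  define R where "R j = face_rank (f (fc j g))" for j
  have range: "R j \<in> {-1..3}" if "j \<in> {-1..3}" for j
    unfolding R_def using face_rank_range face_aut_closed[OF f, of "fc j g"] that g by blast
  have less: "R j < R (j + 1)" if "j \<in> {-1..2}" for j
  proof -
    have "(fc j g, fc (j + 1) g) \<in> face_order" "fc j g \<noteq> fc (j + 1) g"
      using that g face_orderI[of j "j + 1" g] fc_neq[of j "j + 1" g g] by auto
    then have "(f (fc j g), f (fc (j + 1) g)) \<in> face_order" "f (fc j g) \<noteq> f (fc (j + 1) g)"
      using face_aut_order_iff[OF f] face_aut_eq_iff[OF f] that g by auto
    then show ?thesis unfolding R_def
      by (rule abstract_polyhedron.rank_strict_mono[OF abstract_polyhedron_faces])
  qed
  have "i = -1 \<or> i = 0 \<or> i = 1 \<or> i = 2 \<or> i = 3" using g by auto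
  then have "R i = i"
    using less[of "-1"] less[of 0] less[of 1] less[of 2] range[of "-1"] range[of 3] by auto
  then show ?thesis using g by (simp add: R_def)
qed

text \<open>Left multiplication on cosets; the choice of representative is harmless by
  \<open>fc_left_mult_iff\<close>.\<close>

definition translation :: "'a \<Rightarrow> 'f \<Rightarrow> 'f" where
  "translation h = (\<lambda>x \<in> faces.
     fc (face_rank x) (h \<otimes> (SOME g. g \<in> carrier G \<and> x = fc (face_rank x) g)))"

lemma translation_fc:
  assumes "h \<in> carrier G" "i \<in> {-1..3}" "g \<in> carrier G"
  shows "translation h (fc i g) = fc i (h \<otimes> g)"
proof -
  define k where "k = (SOME k. k \<in> carrier G \<and> fc i g = fc i k)"
  have k: "k \<in> carrier G" "fc i g = fc i k"
    unfolding k_def by (rule someI2[of _ g]; use assms in blast)+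
  have "translation h (fc i g) = fc i (h \<otimes> k)"
    using assms by (simp add: translation_def k_def)
  then show ?thesis using fc_left_mult_iff[of i g k h] assms k by simp
qed

lemma translation_in_aut:
  assumes h: "h \<in> carrier G"
  shows "translation h \<in> carrier face_aut"
proof -
  have closed: "translation h x \<in> faces" if "h \<in> carrier G" "x \<in> faces" for h x
    using that by (auto elim!: facesE simp: translation_fc)
  have inverse: "translation k (translation h x) = x"
    if "h \<in> carrier G" "k \<in> carrier G" "k \<otimes> h = \<one>" "x \<in> faces" for h k x
    using \<open>x \<in> faces\<close> that by (auto elim!: facesE simp: translation_fc m_assoc[symmetric])
  have order: "(translation h x, translation h y) \<in> face_order"
    if h: "h \<in> carrier G" and xy: "(x, y) \<in> face_order" for h x y
  proof -
    obtain i j g where "-1 \<le> i" "i \<le> j" "j \<le> 3" "g \<in> carrier G" "x = fc i g" "y = fc j g"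
      using xy by (rule face_orderE)
    then show ?thesis using face_orderI[of i j "h \<otimes> g"] h by (simp add: translation_fc)
  qed
  have "bij_betw (translation h) faces faces"
    by (rule bij_betw_byWitness[of _ "translation (inv h)"]) (use h inverse closed in auto)
  moreover have "(x, y) \<in> face_order \<longleftrightarrow> (translation h x, translation h y) \<in> face_order"
    if "x \<in> faces" "y \<in> faces" for x y
    using order[OF h] order[of "inv h" "translation h x" "translation h y"] inverse[of h "inv h"] h that by auto
  ultimately show ?thesis
    by (auto simp: carrier_face_aut Bij_def translation_def)
qed

text \<open>
  An automorphism is determined by the image of the base flag, because the image of a flag of the first
  orbit propagates along adjacent flags.
\<close>

definition tracks :: "('f \<Rightarrow> 'f) \<Rightarrow> bool \<Rightarrow> 'a \<Rightarrow> 'a \<Rightarrow> bool" where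
  "tracks f b g k \<longleftrightarrow> k \<in> carrier G \<and> f (fc 0 g) = fc 0 k \<and> f (fc 1 g) = fc 1 k \<and>
     f (fc 2 g) = fc 2 (if b then k \<otimes> t else k)"

text \<open>\<open>tracks f b g k\<close> says that \<open>f\<close> takes
  \<open>flag False g\<close> to \<open>flag b k\<close>. A common element of the image vertex and
  image edge supplies \<open>k\<close>; the side of the image 2-face supplies
  \<open>b\<close>.\<close>

lemma tracks_exists:
  assumes f: "f \<in> carrier face_aut" and g: "g \<in> carrier G"
  shows "\<exists>b k. tracks f b g k"
proof -
  have rk: "face_rank (f (fc i g)) = i" if "i \<in> {-1..3}" for i
    using face_aut_rank[OF f, of "fc i g"] that g by simp
  have "(f (fc 0 g), f (fc 1 g)) \<in> face_order"
    using face_aut_order_iff[OF f, of "fc 0 g" "fc 1 g"] face_orderI[of 0 1 g] g by simp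
  then obtain i j k where k: "-1 \<le> i" "i \<le> j" "j \<le> 3" "k \<in> carrier G" "f (fc 0 g) = fc i k" "f (fc 1 g) = fc j k"
    by (rule face_orderE)
  then have ij: "i = 0" "j = 1" using rk[of 0] rk[of 1] by auto
  have "(fc 1 k, f (fc 2 g)) \<in> face_order"
    using face_aut_order_iff[OF f, of "fc 1 g" "fc 2 g"] face_orderI[of 1 2 g] g k ij by simp
  then have "f (fc 2 g) = fc 2 k \<or> f (fc 2 g) = fc 2 (k \<otimes> t)"
    using faces_of_edge[OF k(4)] rk[of 2] by simp
  then show ?thesis
  proof
    assume "f (fc 2 g) = fc 2 k"
    then have "tracks f False g k" using k ij by (simp add: tracks_def)
    then show ?thesis by blast
  next
    assume "f (fc 2 g) = fc 2 (k \<otimes> t)"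
    then have "tracks f True g k" using k ij by (simp add: tracks_def)
    then show ?thesis by blast
  qed
qed

lemma tracks_unique:
  assumes "tracks f b g k" "tracks f b g l"
  shows "k = l"
  using assms fc_meet[of 0 1 k l] by (auto simp: tracks_def)

text \<open>Passing to \<open>g \<otimes> t\<close> exchanges the two vertices and the two 2-faces
  of one edge, and \<open>f\<close> must do the same at the image edge.\<close>

lemma tracks_t:
  assumes f: "f \<in> carrier face_aut" and g: "g \<in> carrier G" and tr: "tracks f b g k"
  shows "tracks f b (g \<otimes> t) (k \<otimes> t)"
proof -
  have k: "k \<in> carrier G" using tr by (simp add: tracks_def)
  have "(fc 0 (g \<otimes> t), fc 1 g) \<in> face_order" "(fc 1 g, fc 2 (g \<otimes> t)) \<in> face_order"
    using face_orderI[of 0 1 "g \<otimes> t"] face_orderI[of 1 2 "g \<otimes> t"] g by simp_all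
  then have "(f (fc 0 (g \<otimes> t)), fc 1 k) \<in> face_order" "(fc 1 k, f (fc 2 (g \<otimes> t))) \<in> face_order"
    using face_aut_order_iff[OF f, of _ "fc 1 g"] face_aut_order_iff[OF f, of "fc 1 g"] tr g
    by (simp_all add: tracks_def)
  moreover have "f (fc 0 (g \<otimes> t)) \<noteq> fc 0 k" "f (fc 2 (g \<otimes> t)) \<noteq> fc 2 (if b then k \<otimes> t else k)"
    using face_aut_eq_iff[OF f, of "fc 0 (g \<otimes> t)" "fc 0 g"] face_aut_eq_iff[OF f, of "fc 2 (g \<otimes> t)" "fc 2 g"]
      fc_0_t_neq[OF g] fc_2_t_neq[OF g] tr g unfolding tracks_def by simp_all
  ultimately have "f (fc 0 (g \<otimes> t)) = fc 0 (k \<otimes> t) \<and> f (fc 2 (g \<otimes> t)) = fc 2 (if b then k else k \<otimes> t)"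
    using vertices_of_edge[OF k, of "f (fc 0 (g \<otimes> t))"] faces_of_edge[OF k, of "f (fc 2 (g \<otimes> t))"]
      face_aut_rank[OF f] g by (cases b) simp_all
  then show ?thesis using tr g k by (simp add: tracks_def)
qed

text \<open>The other edge at the corner of \<open>g\<close> goes to the other edge at the image
  corner. If \<open>b\<close> holds, the image corner is traversed in the opposite sense, which
  turns \<open>inv c\<close> into \<open>c\<close>.\<close>

lemma tracks_inv_c:
  assumes f: "f \<in> carrier face_aut" and g: "g \<in> carrier G" and tr: "tracks f b g k"
  shows "tracks f b (g \<otimes> inv c) (if b then k \<otimes> c else k \<otimes> inv c)"
proof -
  \<comment> \<open>\<open>a\<close> represents the image vertex and the image 2-face
    simultaneously, while \<open>a'\<close> represents the image of the other edge.\<close>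
  define a where "a = (if b then k \<otimes> c else k)"
  define a' where "a' = (if b then k \<otimes> c else k \<otimes> inv c)"
  have k: "k \<in> carrier G" using tr by (simp add: tracks_def)
  have a: "a \<in> carrier G" "a' \<in> carrier G" using k by (auto simp: a_def a'_def)
  have fa: "f (fc 0 g) = fc 0 a" "f (fc 2 g) = fc 2 a" using tr k by (auto simp: tracks_def a_def)
  have "(fc 0 g, fc 1 (g \<otimes> inv c)) \<in> face_order" "(fc 1 (g \<otimes> inv c), fc 2 g) \<in> face_order"
    using face_orderI[of 0 1 "g \<otimes> inv c"] face_orderI[of 1 2 "g \<otimes> inv c \<otimes> t"] g by simp_all
  then have "(fc 0 a, f (fc 1 (g \<otimes> inv c))) \<in> face_order" "(f (fc 1 (g \<otimes> inv c)), fc 2 a) \<in> face_order"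
    using face_aut_order_iff[OF f, of "fc 0 g"] face_aut_order_iff[OF f, of _ "fc 2 g"] fa g by simp_all
  moreover have "f (fc 1 (g \<otimes> inv c)) \<noteq> fc 1 k"
    using face_aut_eq_iff[OF f, of "fc 1 (g \<otimes> inv c)" "fc 1 g"] fc_1_inv_c_neq[OF g] tr g
    unfolding tracks_def by simp
  ultimately have e: "f (fc 1 (g \<otimes> inv c)) = fc 1 a'"
    using edges_at_corner[OF a(1), of "f (fc 1 (g \<otimes> inv c))"] face_aut_rank[OF f] g k
    by (cases b) (simp_all add: a_def a'_def)
  have "(fc 1 (g \<otimes> inv c), fc 2 (g \<otimes> inv c)) \<in> face_order" using face_orderI[of 1 2 "g \<otimes> inv c"] g by simp
  then have "(fc 1 a', f (fc 2 (g \<otimes> inv c))) \<in> face_order"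
    using face_aut_order_iff[OF f, of "fc 1 (g \<otimes> inv c)" "fc 2 (g \<otimes> inv c)"] e g by simp
  moreover have "f (fc 2 (g \<otimes> inv c)) \<noteq> fc 2 a"
    using face_aut_eq_iff[OF f, of "fc 2 (g \<otimes> inv c)" "fc 2 g"] fc_2_t_neq[of "g \<otimes> inv c"] fa g
    by (simp add: eq_commute)
  ultimately have "f (fc 2 (g \<otimes> inv c)) = fc 2 (if b then a' \<otimes> t else a')"
    using faces_of_edge[OF a(2), of "f (fc 2 (g \<otimes> inv c))"] face_aut_rank[OF f] g k
    by (cases b) (simp_all add: a_def a'_def)
  moreover have "f (fc 0 (g \<otimes> inv c)) = fc 0 a'" using tr g k by (simp add: tracks_def a'_def)
  ultimately show ?thesis using e a by (simp add: tracks_def a'_def[symmetric])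
qed

text \<open>By induction along \<open>t\<close> and \<open>inv c\<close>, \<open>f\<close> takes
  \<open>flag False g\<close> to \<open>flag False (h \<otimes> g)\<close> for every
  \<open>g\<close>, just as left multiplication by \<open>h\<close> does.\<close>

lemma tracks_False_imp_translation:
  assumes f: "f \<in> carrier face_aut" and tr: "tracks f False \<one> h"
  shows "f = translation h"
proof (rule extensionalityI[of _ faces])
  have h: "h \<in> carrier G" using tr by (simp add: tracks_def)
  show "f \<in> extensional faces" using f by (simp add: carrier_face_aut Bij_def)
  show "translation h \<in> extensional faces" by (simp add: translation_def)
  have tr_g: "tracks f False g (h \<otimes> g)" if "g \<in> carrier G" for g
    using that
  proof (induction rule: carrier_induct)
    case one then show ?case using tr h by simp
  next
    case (t g) then show ?case using tracks_t[OF f, of g False "h \<otimes> g"] h by (simp add: m_assoc)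
  next
    case (inv_c g) then show ?case using tracks_inv_c[OF f, of g False "h \<otimes> g"] h by (simp add: m_assoc)
  qed
  fix x assume "x \<in> faces"
  then obtain i g where g: "i \<in> {-1..3}" "g \<in> carrier G" "x = fc i g" by (rule facesE)
  show "f x = translation h x"
  proof (cases "i \<in> {-1, 3}")
    case True
    obtain j k where k: "j \<in> {-1..3}" "k \<in> carrier G" "f x = fc j k"
      using face_aut_closed[OF f \<open>x \<in> faces\<close>] by (rule facesE)
    then have "j = i" using face_aut_rank[OF f \<open>x \<in> faces\<close>] g by simp
    then show ?thesis using k g h fc_improper[OF k(2) _ True, of "h \<otimes> g"] by (simp add: translation_fc)
  next
    case False
    then have "i = 0 \<or> i = 1 \<or> i = 2" using g by auto
    then show ?thesis using tr_g[OF g(2)] g h by (auto simp: tracks_def translation_fc)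
  qed
qed

lemma translation_flag:
  assumes h: "h \<in> carrier G" and g: "g \<in> carrier G"
  shows "translation h ` flag b g = flag b (h \<otimes> g)"
  unfolding flag_def image_image using assms
  by (intro image_cong refl) (auto simp: translation_fc m_assoc)

lemma flag_False_neq_True:
  assumes g: "g \<in> carrier G" and h: "h \<in> carrier G"
  shows "flag False g \<noteq> flag True h"
proof
  assume eq: "flag False g = flag True h"
  have "fc i g \<in> flag False g" if "i \<in> {-1..3}" for i
    using that g by (simp add: fc_in_flag_iff)
  then have "fc i g = flag_face True h i" if "i \<in> {-1..3}" for i
    using that eq fc_in_flag_iff[OF h g, of i True] by auto
  from this[of 0] this[of 1] this[of 2] show False
    using fc_meet[of 0 1 g h] fc_2_t_neq[OF h] g h by auto
qed

text \<open>The edges at the face of \<open>g\<close> are those of \<open>g \<otimes> x\<close> with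
  \<open>x\<close> in its stabilizer, and by \<open>fc_meet\<close> different \<open>x\<close> give
  different edges. The symmetric condition treats vertices and 2-faces together.\<close>

lemma card_incident_edges:
  assumes i: "i \<in> {0, 2}" and g: "g \<in> carrier G"
  defines "S \<equiv> {E \<in> faces. face_rank E = 1 \<and> ((E, fc i g) \<in> face_order \<or> (fc i g, E) \<in> face_order)}"
  shows "finite S \<and> card S = card (face_stabilizer i)"
proof -
  have stab: "x \<in> carrier G" if "x \<in> face_stabilizer i" for x
    using that stabilizer_subset by blast
  have "S = (\<lambda>x. fc 1 (g \<otimes> x)) ` face_stabilizer i"
  proof (intro equalityI subsetI)
    fix E assume E: "E \<in> S"
    then obtain k where k: "k \<in> carrier G" "E = fc 1 k"
      by (auto simp: S_def elim!: facesE)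
    obtain l where l: "l \<in> carrier G" "fc 1 l = fc 1 k" "fc i l = fc i g"
      using E k g i face_order_fc_iff[of 1 i k g] face_order_fc_iff[of i 1 g k] by (auto simp: S_def)
    then obtain x where "x \<in> face_stabilizer i" "l = g \<otimes> x"
      by (elim fc_eqE[of i g l, rotated 3, OF sym]) (use g i in auto)
    then show "E \<in> (\<lambda>x. fc 1 (g \<otimes> x)) ` face_stabilizer i" using k l by (metis image_eqI)
  next
    fix E assume "E \<in> (\<lambda>x. fc 1 (g \<otimes> x)) ` face_stabilizer i"
    then obtain x where x: "x \<in> face_stabilizer i" "E = fc 1 (g \<otimes> x)" by blast
    then have "fc i (g \<otimes> x) = fc i g" using fc_eqI[of i g x] i g by auto
    then show "E \<in> S"
      using face_orderI[of 0 1 "g \<otimes> x"] face_orderI[of 1 2 "g \<otimes> x"] i g x stab by (auto simp: S_def)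
  qed
  moreover have "inj_on (\<lambda>x. fc 1 (g \<otimes> x)) (face_stabilizer i)"
  proof (rule inj_onI)
    fix x y assume xy: "x \<in> face_stabilizer i" "y \<in> face_stabilizer i" "fc 1 (g \<otimes> x) = fc 1 (g \<otimes> y)"
    have "fc i (g \<otimes> x) = fc i (g \<otimes> y)" using fc_eqI[of i g] i g xy by auto
    then have "g \<otimes> x = g \<otimes> y" using fc_meet[of i 1 "g \<otimes> x" "g \<otimes> y"] i g xy stab by auto
    then show "x = y" using g xy stab by simp
  qed
  ultimately show ?thesis
    using finite_subset[OF stabilizer_subset finite_carrier] by (simp add: card_image)
qed

lemma has_type_faces:
  "has_type faces face_order face_rank (card (generate G {t \<otimes> c})) (card (generate G {c}))"
  unfolding has_type_def
proof (intro conjI ballI impI)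
  fix F assume "F \<in> faces" "face_rank F = 2"
  then obtain g where g: "g \<in> carrier G" "F = fc 2 g" by (auto elim!: facesE)
  have "{E \<in> faces. face_rank E = 1 \<and> (E, F) \<in> face_order} =
    {E \<in> faces. face_rank E = 1 \<and> ((E, F) \<in> face_order \<or> (F, E) \<in> face_order)}"
    using g face_order_fc_iff[of 2 1 g] by (auto elim!: facesE)
  then show "finite {E \<in> faces. face_rank E = 1 \<and> (E, F) \<in> face_order}"
    "card {E \<in> faces. face_rank E = 1 \<and> (E, F) \<in> face_order} = card (generate G {t \<otimes> c})"
    using card_incident_edges[of 2 g] g by (simp_all add: face_stabilizer_def)
next
  fix v assume "v \<in> faces" "face_rank v = 0"
  then obtain g where g: "g \<in> carrier G" "v = fc 0 g" by (auto elim!: facesE)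
  have "{E \<in> faces. face_rank E = 1 \<and> (v, E) \<in> face_order} =
    {E \<in> faces. face_rank E = 1 \<and> ((E, v) \<in> face_order \<or> (v, E) \<in> face_order)}"
    using g face_order_fc_iff[of 1 0 _ g] by (auto elim!: facesE)
  then show "finite {E \<in> faces. face_rank E = 1 \<and> (v, E) \<in> face_order}"
    "card {E \<in> faces. face_rank E = 1 \<and> (v, E) \<in> face_order} = card (generate G {c})"
    using card_incident_edges[of 0 g] g by (simp_all add: face_stabilizer_def)
qed

end

text \<open>
  An automorphism taking the base flag to its \<open>2\<close>-adjacent flag would induce such a map \<open>\<kappa>\<close>, because
  it conjugates \<open>t\<close> to itself and \<open>c\<close> to its inverse.
\<close>

locale chiral_coset_geometry = coset_geometry +
  assumes no_reflection: "\<And>\<kappa>. \<kappa> \<in> carrier G \<rightarrow> carrier G \<Longrightarrow>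
    (\<And>g. g \<in> carrier G \<Longrightarrow> \<kappa> (g \<otimes> t) = \<kappa> g \<otimes> t) \<Longrightarrow>
    (\<And>g. g \<in> carrier G \<Longrightarrow> \<kappa> (g \<otimes> inv c) = \<kappa> g \<otimes> c) \<Longrightarrow> False"
begin

text \<open>The base flag goes to some \<open>flag b h\<close>. If \<open>b\<close> held, following
  all flags \<open>flag False g\<close> would define the forbidden \<open>\<kappa>\<close>;
  otherwise the automorphism is a translation.\<close>

lemma carrier_face_aut_eq: "carrier face_aut = translation ` carrier G"
proof (intro equalityI subsetI)
  fix f assume f: "f \<in> carrier face_aut"
  obtain b h where tr: "tracks f b \<one> h" using tracks_exists[OF f] by blast
  have "\<not> b"
  proof
    assume b
    have ex: "\<exists>k. tracks f True g k" if "g \<in> carrier G" for g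
      using that
    proof (induction rule: carrier_induct)
      case one then show ?case using tr \<open>b\<close> by auto
    next
      case (t g) then show ?case using tracks_t[OF f, of g True] by blast
    next
      case (inv_c g) then show ?case using tracks_inv_c[OF f, of g True] by auto
    qed
    define \<kappa> where "\<kappa> g = (SOME k. tracks f True g k)" for g
    have \<kappa>: "tracks f True g (\<kappa> g)" if "g \<in> carrier G" for g
      unfolding \<kappa>_def using ex[OF that] by (rule someI_ex)
    show False
    proof (rule no_reflection[of \<kappa>])
      show "\<kappa> \<in> carrier G \<rightarrow> carrier G" using \<kappa> by (auto simp: tracks_def)
      fix g assume g: "g \<in> carrier G"
      show "\<kappa> (g \<otimes> t) = \<kappa> g \<otimes> t"
        using tracks_unique[OF \<kappa> tracks_t[OF f g \<kappa>[OF g]]] g by simp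
      show "\<kappa> (g \<otimes> inv c) = \<kappa> g \<otimes> c"
        using tracks_unique[OF \<kappa>] tracks_inv_c[OF f g \<kappa>[OF g]] g by simp
    qed
  qed
  then show "f \<in> translation ` carrier G"
    using tracks_False_imp_translation[OF f] tr by (auto simp: tracks_def)
next
  fix f assume "f \<in> translation ` carrier G"
  then show "f \<in> carrier face_aut" using translation_in_aut by blast
qed

lemma card_face_aut: "card (carrier face_aut) = card (carrier G)"
proof -
  have "inj_on translation (carrier G)"
  proof (rule inj_onI)
    fix g h assume gh: "g \<in> carrier G" "h \<in> carrier G" "translation g = translation h"
    then have "fc i g = fc i h" if "i \<in> {-1..3}" for i
      using translation_fc[of g i \<one>] translation_fc[of h i \<one>] that by simp
    then show "g = h" using fc_meet[of 0 1 g h] gh by simp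
  qed
  then show ?thesis by (simp add: carrier_face_aut_eq card_image)
qed

lemma flag_orbit_flag:
  assumes "g \<in> carrier G"
  shows "flag_orbit faces face_order (flag b g) = flag b ` carrier G"
proof -
  have "flag_orbit faces face_order (flag b g) = (\<lambda>h. flag b (h \<otimes> g)) ` carrier G"
  proof -
    have "flag_orbit faces face_order (flag b g) = (\<lambda>h. translation h ` flag b g) ` carrier G"
      unfolding flag_orbit_def orbit_def carrier_face_aut_eq by blast
    also have "\<dots> = (\<lambda>h. flag b (h \<otimes> g)) ` carrier G"
      by (intro image_cong refl translation_flag assms)
    finally show ?thesis .
  qed
  also have "\<dots> = flag b ` (\<lambda>h. h \<otimes> g) ` carrier G" by (simp add: image_image)
  also have "(\<lambda>h. h \<otimes> g) ` carrier G = carrier G"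
  proof (intro equalityI subsetI)
    fix x assume "x \<in> carrier G"
    then have "x = x \<otimes> inv g \<otimes> g" "x \<otimes> inv g \<in> carrier G" using assms by (simp_all add: m_assoc)
    then show "x \<in> (\<lambda>h. h \<otimes> g) ` carrier G" by blast
  qed (use assms in auto)
  finally show ?thesis .
qed

lemma flag_orbits_disjoint: "flag False ` carrier G \<noteq> flag True ` carrier G"
  using flag_False_neq_True[OF one_closed] one_closed by blast

lemma chiral_polyhedron_faces: "chiral_polyhedron faces face_order face_rank"
proof (intro chiral_polyhedron.intro chiral_polyhedron_axioms.intro abstract_polyhedron_faces)
  have "orbits face_aut (flags face_order) image = {flag False ` carrier G, flag True ` carrier G}"
  proof -
    have "orbits face_aut (flags face_order) image = {flag_orbit faces face_order (flag b g) | b g. g \<in> carrier G}"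
      unfolding orbits_def flags_eq flag_orbit_def by blast
    also have "\<dots> = {flag b ` carrier G | b. True}"
      using flag_orbit_flag one_closed by metis
    also have "\<dots> = {flag False ` carrier G, flag True ` carrier G}"
      by (simp add: set_eq_iff ex_bool_eq) blast
    finally show ?thesis .
  qed
  then show "card (orbits face_aut (flags face_order) image) = 2"
    using flag_orbits_disjoint by simp
next
  fix A B assume adj: "adjacent_flags face_order A B"
  then obtain b g b' h where g: "g \<in> carrier G" "A = flag b g" and h: "h \<in> carrier G" "B = flag b' h"
    unfolding adjacent_flags_def flags_eq by blast
  then have "b \<noteq> b'" using adj adjacent_flags_alternate by blast
  then show "flag_orbit faces face_order A \<noteq> flag_orbit faces face_order B"
    using flag_orbit_flag g h flag_orbits_disjoint by (cases b; cases b') auto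
qed

end

text \<open>The coset geometry can be realised on natural numbers because there are only finitely many cosets.\<close>

theorem (in rotary_group) nat_chiral_polyhedron_exists:
  assumes no_reflection: "\<And>\<kappa>. \<kappa> \<in> carrier G \<rightarrow> carrier G \<Longrightarrow>
    (\<And>g. g \<in> carrier G \<Longrightarrow> \<kappa> (g \<otimes> t) = \<kappa> g \<otimes> t) \<Longrightarrow>
    (\<And>g. g \<in> carrier G \<Longrightarrow> \<kappa> (g \<otimes> inv c) = \<kappa> g \<otimes> c) \<Longrightarrow> False"
    and non_tight: "card (generate G {t \<otimes> c}) * card (generate G {c}) \<noteq> card (carrier G)"
  shows "\<exists>(P :: nat set) r rk. chiral_polyhedron P r rk \<and> non_tight P r rk \<and>
    card (carrier (poset_aut P r)) = card (carrier G)"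
proof -
  \<comment> \<open>The rank is part of the label because the cosets for ranks -1 and 3 are the same
    set.\<close>
  define S where "S = (\<lambda>(i, g). (i, l_coset G g (face_stabilizer i))) ` ({-1..3::int} \<times> carrier G)"
  have "finite S" using finite_carrier by (simp add: S_def)
  then obtain e :: "int \<times> 'a set \<Rightarrow> nat" where e: "inj_on e S"
    using finite_imp_inj_to_nat_seg by metis
  define fc where "fc i g = e (i, l_coset G g (face_stabilizer i))" for i g
  have coset_eq: "l_coset G g H = l_coset G h H \<longleftrightarrow> inv g \<otimes> h \<in> H" if H: "subgroup H G" and g: "g \<in> carrier G" and h: "h \<in> carrier G" for g h H
  proof
    assume "l_coset G g H = l_coset G h H"
    moreover have "h \<in> l_coset G h H" using subgroup.one_closed[OF H] h by (force simp: l_coset_def)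
    ultimately obtain x where "x \<in> H" "h = g \<otimes> x" by (auto simp: l_coset_def)
    then show "inv g \<otimes> h \<in> H" using subgroup.mem_carrier[OF H] g by (simp add: m_assoc[symmetric])
  next
    assume x: "inv g \<otimes> h \<in> H"
    have h_eq: "h = g \<otimes> (inv g \<otimes> h)" using g h by (simp add: m_assoc[symmetric])
    have "h \<in> l_coset G g H" unfolding l_coset_def using x h_eq by blast
    then show "l_coset G g H = l_coset G h H" using l_repr_independence[OF _ g H] by blast
  qed
  interpret chiral_coset_geometry G t c fc
  proof (unfold_locales, goal_cases)
    case (1 i j g h)
    then have "(i, l_coset G g (face_stabilizer i)) \<in> S" "(j, l_coset G h (face_stabilizer j)) \<in> S"
      by (auto simp: S_def)
    then have "fc i g = fc j h \<longleftrightarrow> i = j \<and> l_coset G g (face_stabilizer i) = l_coset G h (face_stabilizer j)"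
      using inj_on_eq_iff[OF e] by (simp add: fc_def)
    then show ?case using coset_eq[OF subgroup_stabilizer] 1 by auto
  next
    case (2 \<kappa>) then show ?case by (rule no_reflection)
  qed
  have "non_tight faces face_order face_rank"
    unfolding non_tight_def card_face_aut using has_type_faces non_tight by fastforce
  then show ?thesis
    using chiral_polyhedron_faces card_face_aut by blast
qed

section \<open>Cyclic extensions of finite modules\<close>

type_synonym triple = "int \<times> int \<times> int"

fun scale :: "int \<Rightarrow> triple \<Rightarrow> triple" where
  "scale m (a, b, c) = (m * a, m * b, m * c)"

lemma scale_add_left: "scale (m + n) x = scale m x + scale n x"
  by (cases x) (simp add: algebra_simps)

lemma scale_simps [simp]: "scale 0 x = 0" "scale 1 x = x" "scale m 0 = 0"
  by (cases x; simp add: zero_prod_def)+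

text \<open>
  The module is \<open>\<int>\<^sup>3 / K\<close> with \<open>K = n\<^sub>1\<int> \<times> n\<^sub>2\<int> \<times> n\<^sub>3\<int>\<close>; the set comprehensions in the assumptions spell out
  \<open>K\<close>, which is only defined afterwards.
\<close>

locale finite_module_automorphism =
  fixes n1 n2 n3 q :: nat and U :: "triple \<Rightarrow> triple"
  assumes pos: "n1 > 0" "n2 > 0" "n3 > 0"
    and q: "odd q" "q > 1"
    and U_add: "\<And>x y. U (x + y) = U x + U y"
    and U_kernel: "\<And>a b c. int n1 dvd a \<Longrightarrow> int n2 dvd b \<Longrightarrow> int n3 dvd c \<Longrightarrow>
      U (a, b, c) \<in> {(a, b, c). int n1 dvd a \<and> int n2 dvd b \<and> int n3 dvd c}"
    and U_order: "\<And>x. (U ^^ q) x - x \<in> {(a, b, c). int n1 dvd a \<and> int n2 dvd b \<and> int n3 dvd c}"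
begin

definition K :: "triple set" where
  "K = {(a, b, c). int n1 dvd a \<and> int n2 dvd b \<and> int n3 dvd c}"

definition red :: "triple \<Rightarrow> triple" where
  "red x = (case x of (a, b, c) \<Rightarrow> (a mod int n1, b mod int n2, c mod int n3))"

text \<open>The \<open>k\<close>-th power of \<open>- U\<close>, that is the action of the
  \<open>k\<close>-th power of \<open>c\<close>.\<close>

definition act :: "nat \<Rightarrow> triple \<Rightarrow> triple" where
  "act k x = (if even k then (U ^^ k) x else - (U ^^ k) x)"

definition e0 :: triple where
  "e0 = (1, 0, 0)"

section \<open>Arithmetic modulo \<open>K\<close> and the action of the cyclic group\<close>

lemma red_eq_iff: "red x = red y \<longleftrightarrow> x - y \<in> K"
  by (cases x; cases y) (simp add: red_def K_def mod_eq_dvd_iff)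

lemma red_red [simp]: "red (red x) = red x"
  by (cases x) (simp add: red_def)

lemma red_zero [simp]: "red 0 = 0"
  by (simp add: red_def zero_prod_def)

lemma K_zero [simp]: "0 \<in> K"
  by (simp add: K_def zero_prod_def)

lemma K_add: "x \<in> K \<Longrightarrow> y \<in> K \<Longrightarrow> x + y \<in> K"
  by (auto simp: K_def)

lemma K_uminus: "x \<in> K \<Longrightarrow> - x \<in> K"
  by (auto simp: K_def)

lemma K_diff: "x \<in> K \<Longrightarrow> y \<in> K \<Longrightarrow> x - y \<in> K"
  by (auto simp: K_def)

lemma red_zero_iff: "red x = 0 \<longleftrightarrow> x \<in> K"
  using red_eq_iff[of x 0] by simp

lemma red_cong_add: "red x = red x' \<Longrightarrow> red y = red y' \<Longrightarrow> red (x + y) = red (x' + y')"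
  using K_add[of "x - x'" "y - y'"] by (simp add: red_eq_iff algebra_simps)

lemma U_zero [simp]: "U 0 = 0"
  using U_add[of 0 0] by simp

lemma U_uminus: "U (- x) = - U x"
  using U_add[of x "- x"] by (simp add: eq_neg_iff_add_eq_0 add.commute)

lemma U_diff: "U (x - y) = U x - U y"
  using U_add[of x "- y"] by (simp add: U_uminus)

lemma U_pow_add: "(U ^^ k) (x + y) = (U ^^ k) x + (U ^^ k) y"
  by (induction k) (simp_all add: U_add)

lemma U_pow_uminus: "(U ^^ k) (- x) = - (U ^^ k) x"
  by (induction k) (simp_all add: U_uminus)

lemma U_pow_zero [simp]: "(U ^^ k) 0 = 0"
  by (induction k) simp_all

lemma U_pow_diff: "(U ^^ k) (x - y) = (U ^^ k) x - (U ^^ k) y"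
  by (induction k) (simp_all add: U_diff)

lemma U_pow_K: "x \<in> K \<Longrightarrow> (U ^^ k) x \<in> K"
  by (induction k) (use U_kernel in \<open>auto simp: K_def\<close>)

lemma scale_add_right: "scale m (x + y) = scale m x + scale m y"
  by (cases x; cases y) (simp add: algebra_simps)

lemma scale_uminus: "scale (- m) x = - scale m x"
  by (cases x) simp

lemma scale_K: "x \<in> K \<Longrightarrow> scale m x \<in> K"
  by (auto simp: K_def)

lemma red_scale_cong: "red x = red y \<Longrightarrow> red (scale m x) = red (scale m y)"
  using scale_K[of "x - y" m] by (cases x; cases y) (simp add: red_eq_iff algebra_simps)

lemma U_pow_scale: "(U ^^ k) (scale m x) = scale m ((U ^^ k) x)"
proof -
  have *: "(U ^^ k) (scale (int n) x) = scale (int n) ((U ^^ k) x)" for n x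
    by (induction n) (simp_all add: scale_add_left U_pow_add)
  show ?thesis
  proof (cases m)
    case (neg n)
    then show ?thesis using *[of "Suc n" x] by (simp only: scale_uminus U_pow_uminus)
  qed (simp add: *)
qed

lemma U_pow_sum: "finite A \<Longrightarrow> (U ^^ k) (\<Sum>j\<in>A. f j) = (\<Sum>j\<in>A. (U ^^ k) (f j))"
  by (induction A rule: finite_induct) (simp_all add: U_pow_add)

lemma red_U_pow_cong: "red x = red y \<Longrightarrow> red ((U ^^ k) x) = red ((U ^^ k) y)"
  using U_pow_K[of "x - y" k] by (simp add: red_eq_iff U_pow_diff)

lemma red_U_pow_mult: "red ((U ^^ (q * k)) x) = red x"
proof (induction k)
  case (Suc k)
  have "(U ^^ (q * Suc k)) x = (U ^^ q) ((U ^^ (q * k)) x)"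
    by (simp add: funpow_add)
  also have "red \<dots> = red ((U ^^ (q * k)) x)"
    using U_order by (simp add: red_eq_iff K_def)
  finally show ?case using Suc by simp
qed simp

lemma red_U_pow_add_mult: "red ((U ^^ (j + q * k)) x) = red ((U ^^ j) x)"
  using red_U_pow_cong[OF red_U_pow_mult] by (simp add: funpow_add)

lemma act_0 [simp]: "act 0 x = x"
  by (simp add: act_def)

lemma act_zero [simp]: "act k 0 = 0"
  by (simp add: act_def)

lemma act_add: "act k (x + y) = act k x + act k y"
  by (simp add: act_def U_pow_add)

lemma act_act: "act j (act k x) = act (j + k) x"
  by (simp add: act_def U_pow_uminus funpow_add)

lemma red_act_cong: "red x = red y \<Longrightarrow> red (act k x) = red (act k y)"
  using U_pow_K[of "x - y" k] K_uminus[of "(U ^^ k) (x - y)"] by (auto simp: act_def red_eq_iff U_pow_diff)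

lemma red_act_mult: "red (act (2 * q * k) x) = red x"
  using red_U_pow_mult[of "2 * k" x] by (simp add: act_def mult.assoc mult.left_commute)

lemma red_act_mod: "red (act (k mod (2 * q)) x) = red (act k x)"
proof -
  have "act k x = act (k mod (2 * q)) (act (2 * q * (k div (2 * q))) x)"
    by (simp add: act_act)
  then show ?thesis using red_act_cong[OF red_act_mult] by metis
qed

text \<open>As \<open>Suc q\<close> is even and the \<open>q\<close>-th power of \<open>U\<close> is
  trivial modulo \<open>K\<close>, the element \<open>c\<close> to the power \<open>Suc q\<close>
  acts as \<open>U\<close> without sign. This explains the exponents \<open>j * Suc q\<close>
  below.\<close>

lemma red_act_even: "red (act (j * Suc q) x) = red ((U ^^ j) x)"
proof -
  have "even (j * Suc q)" using q by simp
  then have "act (j * Suc q) x = (U ^^ (j + q * j)) x"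
    by (simp add: act_def algebra_simps)
  then show ?thesis by (simp only: red_U_pow_add_mult)
qed

text \<open>\<open>el x k\<close> is the element \<open>(x + K, c\<^sup>k)\<close> of the semidirect product \<open>aff\<close>.\<close>

definition el :: "triple \<Rightarrow> nat \<Rightarrow> triple \<times> nat" where
  "el x k = (red x, k mod (2 * q))"

definition aff :: "(triple \<times> nat) monoid" where
  "aff = \<lparr>carrier = range red \<times> {..<2 * q},
     monoid.mult = (\<lambda>(x, k) (y, l). (red (x + act k y), (k + l) mod (2 * q))), monoid.one = (0, 0)\<rparr>"

section \<open>The semidirect product and powers of its elements\<close>

lemma el_eq_iff: "el x k = el y l \<longleftrightarrow> x - y \<in> K \<and> k mod (2 * q) = l mod (2 * q)"
  by (simp add: el_def red_eq_iff)

lemma el_add_mult: "el x (k + 2 * q * n) = el x k"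
  by (simp only: el_def mod_mult_self2)

lemma carrier_aff: "carrier aff = {el x k | x k. True}"
proof (intro equalityI subsetI)
  fix g assume "g \<in> carrier aff"
  then obtain x k where "g = (red x, k)" "k < 2 * q" by (auto simp: aff_def)
  then have "g = el x k" by (simp add: el_def)
  then show "g \<in> {el x k | x k. True}" by blast
next
  fix g assume "g \<in> {el x k | x k. True}"
  then show "g \<in> carrier aff" using q by (auto simp: aff_def el_def)
qed

lemma el_in_carrier [simp]: "el x k \<in> carrier aff"
  unfolding carrier_aff by blast

lemma aff_one: "\<one>\<^bsub>aff\<^esub> = el 0 0"
  by (simp add: aff_def el_def)

lemma el_mult [simp]: "el x k \<otimes>\<^bsub>aff\<^esub> el y l = el (x + act k y) (k + l)"
proof -
  have "red (act (k mod (2 * q)) (red y)) = red (act k y)"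
    using red_act_mod red_act_cong[OF red_red] by metis
  then have "red (red x + act (k mod (2 * q)) (red y)) = red (x + act k y)"
    by (intro red_cong_add) simp_all
  then show ?thesis by (simp add: aff_def el_def mod_add_eq)
qed

lemma group_aff: "group aff"
proof (rule groupI)
  fix g h k assume "g \<in> carrier aff" "h \<in> carrier aff" "k \<in> carrier aff"
  then show "g \<otimes>\<^bsub>aff\<^esub> h \<otimes>\<^bsub>aff\<^esub> k = g \<otimes>\<^bsub>aff\<^esub> (h \<otimes>\<^bsub>aff\<^esub> k)"
    by (auto simp: carrier_aff act_add act_act add.assoc)
next
  fix g assume "g \<in> carrier aff"
  then obtain x k where g: "g = el x k" unfolding carrier_aff by blast
  \<comment> \<open>A natural number representing \<open>- k\<close> modulo
    \<open>2 * q\<close>.\<close>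
  define l where "l = (2 * q - 1) * k"
  have "l + k = 2 * q * k"
    using q by (cases "2 * q") (auto simp: l_def)
  then have "el (- act l x) l \<otimes>\<^bsub>aff\<^esub> g = \<one>\<^bsub>aff\<^esub>"
    by (simp add: g aff_one el_eq_iff)
  then show "\<exists>h\<in>carrier aff. h \<otimes>\<^bsub>aff\<^esub> g = \<one>\<^bsub>aff\<^esub>"
    using el_in_carrier by blast
next
  fix g h assume "g \<in> carrier aff" "h \<in> carrier aff"
  then obtain x k y l where "g = el x k" "h = el y l" unfolding carrier_aff by blast
  then show "g \<otimes>\<^bsub>aff\<^esub> h \<in> carrier aff" by simp
next
  fix g assume "g \<in> carrier aff"
  then obtain x k where "g = el x k" unfolding carrier_aff by blast
  then show "\<one>\<^bsub>aff\<^esub> \<otimes>\<^bsub>aff\<^esub> g = g" by (simp add: aff_one)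
qed (simp add: aff_one)

lemma card_carrier_aff: "card (carrier aff) = 2 * q * (n1 * n2 * n3)"
proof -
  have "range red = {0..<int n1} \<times> {0..<int n2} \<times> {0..<int n3}"
  proof (intro equalityI subsetI)
    fix x assume "x \<in> {0..<int n1} \<times> {0..<int n2} \<times> {0..<int n3}"
    then have "red x = x" by (auto simp: red_def)
    then show "x \<in> range red" by (metis rangeI)
  qed (use pos in \<open>auto simp: red_def\<close>)
  then show ?thesis by (simp add: aff_def card_cartesian_product)
qed

interpretation aff: group aff
  by (rule group_aff)

lemma el_pow: "el 0 (Suc 0) [^]\<^bsub>aff\<^esub> k = el 0 k"
  by (induction k) (simp_all add: aff_one)

lemma el_translation_pow: "el x 0 [^]\<^bsub>aff\<^esub> k = el (scale (int k) x) 0"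
  by (induction k) (simp_all add: aff_one scale_add_left add.commute)

lemma inv_el: "inv\<^bsub>aff\<^esub> el 0 (Suc 0) = el 0 (2 * q - 1)"
  by (rule aff.inv_equality) (use q in \<open>simp_all add: aff_one el_eq_iff\<close>)

text \<open>The module part of the powers of \<open>\<sigma>\<^sub>1\<close>.\<close>

definition orbit_sum :: "nat \<Rightarrow> triple" where
  "orbit_sum k = (\<Sum>j<k. (U ^^ j) e0)"

text \<open>The rotation is \<open>e0\<close> followed by an element acting as \<open>U\<close>, so
  its powers accumulate a geometric sum in \<open>U\<close>.\<close>

lemma el_rotation_pow: "el e0 (Suc q) [^]\<^bsub>aff\<^esub> k = el (orbit_sum k) (k * Suc q)"
proof (induction k)
  case (Suc k)
  have "red (orbit_sum k + act (k * Suc q) e0) = red (orbit_sum k + (U ^^ k) e0)"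
    by (rule red_cong_add[OF refl red_act_even])
  then show ?case using Suc by (simp add: el_eq_iff orbit_sum_def red_eq_iff ac_simps)
qed (simp add: aff_one orbit_sum_def)

text \<open>Conjugating the translation by \<open>e0\<close> applies powers of \<open>U\<close> to
  it; the last factor is the inverse of the first.\<close>

lemma el_conjugate: "el 0 (j * Suc q) \<otimes>\<^bsub>aff\<^esub> el e0 0 \<otimes>\<^bsub>aff\<^esub> el 0 ((2 * q - 1) * (j * Suc q)) = el ((U ^^ j) e0) 0"
proof -
  have "j * Suc q + (2 * q - 1) * (j * Suc q) = 2 * q * (j * Suc q)"
    using q by (cases "2 * q") auto
  then show ?thesis
    using red_act_even[of j e0] by (simp add: el_eq_iff red_eq_iff)
qed

end

text \<open>
  \<open>q * e\<close> is a multiple of the order of \<open>\<sigma>\<^sub>1\<close>, so its bound makes the polyhedron non-tight. The reversed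
  relation arises from \<open>relation\<close> by replacing \<open>U\<close> by its inverse and then applying \<open>U\<^sup>d\<close>.
\<close>

locale chiral_module_automorphism = finite_module_automorphism +
  fixes e d :: nat and f :: "nat \<Rightarrow> int"
  assumes generated: "\<And>x. \<exists>a b c. x - (scale a e0 + scale b (U e0) + scale c (U (U e0))) \<in> K"
    and orbit_sum_in_K: "\<And>k. orbit_sum k \<in> K \<Longrightarrow> q dvd k"
    and e: "0 < e" "q * e < n1 * n2 * n3" "scale (int e) (orbit_sum q) \<in> K"
    and relation: "(\<Sum>j\<le>d. scale (f j) ((U ^^ j) e0)) \<in> K"
    and no_reversed_relation: "(\<Sum>j\<le>d. scale (f j) ((U ^^ (d - j)) e0)) \<notin> K"
begin

interpretation aff: group aff
  by (rule group_aff)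

abbreviation "tt \<equiv> el e0 q"
abbreviation "cc \<equiv> el 0 (Suc 0)"

section \<open>Generation, intersection, non-tightness and chirality of the group\<close>

lemma finite_carrier_aff: "finite (carrier aff)"
  using card_carrier_aff pos q by (intro card_ge_0_finite) simp

lemma generate_cc: "generate aff {cc} = {el 0 k | k. True}"
  using aff.generate_pow_on_finite_carrier[OF finite_carrier_aff, of cc] by (auto simp: el_pow)

lemma generate_tt_cc: "generate aff {tt \<otimes>\<^bsub>aff\<^esub> cc} = {el (orbit_sum k) (k * Suc q) | k. True}"
  using aff.generate_pow_on_finite_carrier[OF finite_carrier_aff, of "el e0 (Suc q)"]
  by (auto simp: el_rotation_pow)

lemma two_q_dvd: "q dvd k \<Longrightarrow> 2 * q dvd k * Suc q"
  using q mult_dvd_mono[of q k 2 "q + 1"] by (simp add: mult.commute)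

text \<open>By \<open>generated\<close> every element is, modulo \<open>K\<close>, an integer
  combination of vectors of the \<open>U\<close>-orbit of \<open>e0\<close>.\<close>

lemma induct_orbit:
  assumes zero: "P 0"
    and step: "\<And>x j. P x \<Longrightarrow> P (x + (U ^^ j) e0)"
    and cong: "\<And>x y. P x \<Longrightarrow> x - y \<in> K \<Longrightarrow> P y"
  shows "P x"
proof -
  have scaled: "P (x + scale m ((U ^^ j) e0))" if "P x" for x m j
  proof -
    \<comment> \<open>The product of the moduli annihilates the module, so an integer multiple may
      be replaced by a natural one.\<close>
    let ?N = "int (n1 * n2 * n3)" and ?v = "(U ^^ j) e0"
    have nat: "P (x + scale (int n) ?v)" for n
    proof (induction n)
      case (Suc n)
      then show ?case using step[of "x + scale (int n) ?v" j] by (simp add: scale_add_left ac_simps)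
    qed (use \<open>P x\<close> in simp)
    have "?N dvd m mod ?N - m" by (simp add: mod_eq_dvd_iff[symmetric])
    then have "scale (m mod ?N - m) ?v \<in> K"
      by (cases ?v) (auto simp: K_def intro: dvd_mult2 dvd_trans)
    moreover have "scale (m mod ?N - m) ?v = x + scale (m mod ?N) ?v - (x + scale m ?v)"
      using scale_add_left[of "m mod ?N" "- m" ?v] by (simp add: scale_uminus)
    ultimately show ?thesis
      using cong[of "x + scale (m mod ?N) ?v"] nat[of "nat (m mod ?N)"] pos by simp
  qed
  obtain a b c where abc: "x - (scale a e0 + scale b (U e0) + scale c (U (U e0))) \<in> K"
    using generated by blast
  have "P (0 + scale a ((U ^^ 0) e0) + scale b ((U ^^ 1) e0) + scale c ((U ^^ 2) e0))"
    by (intro scaled zero)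
  then have "P (scale a e0 + scale b (U e0) + scale c (U (U e0)))"
    by (simp add: numeral_2_eq_2)
  then show ?thesis using cong K_uminus[OF abc] by simp
qed

text \<open>Multiplying \<open>tt\<close> by the \<open>q\<close>-th power of \<open>cc\<close>
  leaves the translation by \<open>e0\<close>; its conjugates yield all translations.\<close>

lemma generate_tt_cc_eq: "generate aff {tt, cc} = carrier aff"
proof
  let ?H = "generate aff {tt, cc}"
  have H: "subgroup ?H aff" by (rule aff.generate_is_subgroup) simp
  have mult: "g \<otimes>\<^bsub>aff\<^esub> h \<in> ?H" if "g \<in> ?H" "h \<in> ?H" for g h
    using subgroup.m_closed[OF H that] .
  have cc_pow: "el 0 k \<in> ?H" for k
    using subgroup.subgroup_is_submonoid[OF H] aff.mono_generate[of "{cc}" "{tt, cc}"] generate_cc by blast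
  have "tt \<in> ?H" by (simp add: generate.incl)
  then have "tt \<otimes>\<^bsub>aff\<^esub> el 0 q \<in> ?H" using mult cc_pow by blast
  moreover have "tt \<otimes>\<^bsub>aff\<^esub> el 0 q = el e0 0" by (simp add: el_eq_iff mult_2[symmetric])
  ultimately have e0: "el e0 0 \<in> ?H" by simp
  have "el x 0 \<in> ?H" for x
  proof (rule induct_orbit[of "\<lambda>x. el x 0 \<in> ?H"])
    show "el 0 0 \<in> ?H" using cc_pow .
    fix x j assume "el x 0 \<in> ?H"
    moreover have "el ((U ^^ j) e0) 0 \<in> ?H"
      unfolding el_conjugate[symmetric] by (intro mult cc_pow e0)
    ultimately have "el x 0 \<otimes>\<^bsub>aff\<^esub> el ((U ^^ j) e0) 0 \<in> ?H" by (rule mult)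
    then show "el (x + (U ^^ j) e0) 0 \<in> ?H" by simp
  next
    fix x y assume "el x 0 \<in> ?H" "x - y \<in> K"
    then show "el y 0 \<in> ?H" using el_eq_iff[of x 0 y 0] by simp
  qed
  then have "el x 0 \<otimes>\<^bsub>aff\<^esub> el 0 k \<in> ?H" for x k using mult cc_pow by blast
  then show "carrier aff \<subseteq> ?H" by (auto simp: carrier_aff)
  show "?H \<subseteq> carrier aff" using subgroup.subset[OF H] .
qed

lemma rotary_aff: "rotary_group aff tt cc"
proof (intro rotary_group.intro rotary_group_axioms.intro group_aff finite_carrier_aff el_in_carrier generate_tt_cc_eq)
  \<comment> \<open>\<open>tt\<close> is an involution because \<open>act q\<close> is negation
    modulo \<open>K\<close>, \<open>q\<close> being odd.\<close>
  have "e0 + act q e0 = - ((U ^^ q) e0 - e0)" using q by (simp add: act_def)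
  then have "e0 + act q e0 \<in> K" using K_uminus[OF U_order[of e0, folded K_def]] by simp
  then show "tt \<otimes>\<^bsub>aff\<^esub> tt = \<one>\<^bsub>aff\<^esub>" by (simp add: aff_one el_eq_iff mult_2[symmetric])
  show "cc \<noteq> \<one>\<^bsub>aff\<^esub>" using q by (simp add: aff_one el_eq_iff)
  show "tt \<otimes>\<^bsub>aff\<^esub> cc \<noteq> \<one>\<^bsub>aff\<^esub>" using q by (simp add: aff_one el_eq_iff)
  \<comment> \<open>A power of the rotation lying in the cyclic group of \<open>cc\<close> has
    trivial module part, which forces \<open>q dvd k\<close> and with it a trivial exponent of
    \<open>cc\<close>.\<close>
  have "x = \<one>\<^bsub>aff\<^esub>" if "x \<in> generate aff {tt \<otimes>\<^bsub>aff\<^esub> cc}" "x \<in> generate aff {cc}" for x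
  proof -
    obtain k where x: "x = el (orbit_sum k) (k * Suc q)" using \<open>x \<in> generate aff {tt \<otimes>\<^bsub>aff\<^esub> cc}\<close> generate_tt_cc by blast
    obtain l where "x = el 0 l" using \<open>x \<in> generate aff {cc}\<close> generate_cc by blast
    then have "orbit_sum k \<in> K" using x by (simp add: el_eq_iff)
    then show ?thesis using x two_q_dvd[OF orbit_sum_in_K] by (simp add: aff_one el_eq_iff mod_eq_0_iff_dvd)
  qed
  moreover have "\<one>\<^bsub>aff\<^esub> \<in> generate aff {tt \<otimes>\<^bsub>aff\<^esub> cc} \<inter> generate aff {cc}"
    by (simp add: generate.one)
  ultimately show "generate aff {tt \<otimes>\<^bsub>aff\<^esub> cc} \<inter> generate aff {cc} = {\<one>\<^bsub>aff\<^esub>}" by blast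
qed

text \<open>The order of \<open>cc\<close> is \<open>2 * q\<close>. The \<open>q\<close>-th power of
  the rotation is a translation killed by \<open>e\<close>, so the rotation has order at most
  \<open>q * e\<close>, too small for tightness.\<close>

lemma non_tight_aff: "card (generate aff {tt \<otimes>\<^bsub>aff\<^esub> cc}) * card (generate aff {cc}) \<noteq> card (carrier aff)"
proof -
  have "generate aff {cc} = el 0 ` {..<2 * q}"
  proof -
    have "el 0 k = el 0 (k mod (2 * q))" for k by (simp add: el_def)
    moreover have "k mod (2 * q) < 2 * q" for k using q by simp
    ultimately show ?thesis unfolding generate_cc by blast
  qed
  moreover have "inj_on (el 0) {..<2 * q}" by (auto simp: inj_on_def el_eq_iff)
  ultimately have cc: "card (generate aff {cc}) = 2 * q" by (simp add: card_image)
  have "el e0 (Suc q) [^]\<^bsub>aff\<^esub> q = el (orbit_sum q) 0"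
    unfolding el_rotation_pow using two_q_dvd[of q] by (simp add: el_eq_iff mod_eq_0_iff_dvd)
  then have "el e0 (Suc q) [^]\<^bsub>aff\<^esub> (q * e) = el (scale (int e) (orbit_sum q)) 0"
    using aff.nat_pow_pow[of "el e0 (Suc q)" q e] by (simp add: el_translation_pow)
  also have "\<dots> = \<one>\<^bsub>aff\<^esub>" using e(3) by (simp add: aff_one el_eq_iff)
  finally have "el e0 (Suc q) [^]\<^bsub>aff\<^esub> (q * e) = \<one>\<^bsub>aff\<^esub>" .
  then have "aff.ord (el e0 (Suc q)) dvd q * e"
    using aff.pow_eq_id by simp
  then have "aff.ord (el e0 (Suc q)) \<le> q * e"
    using e(1) q by (intro dvd_imp_le) auto
  then have "card (generate aff {tt \<otimes>\<^bsub>aff\<^esub> cc}) < n1 * n2 * n3"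
    using aff.generate_pow_card[of "el e0 (Suc q)"] e(2) by simp
  then show ?thesis using cc q by (simp add: card_carrier_aff)
qed

text \<open>Under \<open>\<kappa>\<close>, right translation by the \<open>j\<close>-th
  \<open>U\<close>-image of \<open>e0\<close> becomes translation by its image under the inverse
  power. Applied to \<open>relation\<close>, this gives the reversed relation after multiplying by
  the \<open>d\<close>-th power of \<open>U\<close>.\<close>

lemma no_reflection_aff:
  assumes \<kappa>: "\<kappa> \<in> carrier aff \<rightarrow> carrier aff"
    and \<kappa>_t: "\<And>g. g \<in> carrier aff \<Longrightarrow> \<kappa> (g \<otimes>\<^bsub>aff\<^esub> tt) = \<kappa> g \<otimes>\<^bsub>aff\<^esub> tt"
    and \<kappa>_c: "\<And>g. g \<in> carrier aff \<Longrightarrow> \<kappa> (g \<otimes>\<^bsub>aff\<^esub> inv\<^bsub>aff\<^esub> cc) = \<kappa> g \<otimes>\<^bsub>aff\<^esub> cc"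
  shows False
proof -
  note [simp del] = el_mult
  \<comment> \<open>Stands for -1 modulo \<open>2 * q\<close>, so that inverse powers have natural
    exponents.\<close>
  let ?r = "2 * q - 1"
  have closed [simp]: "\<kappa> g \<in> carrier aff" if "g \<in> carrier aff" for g using \<kappa> that by auto
  have el_0_add: "el 0 k \<otimes>\<^bsub>aff\<^esub> el 0 l = el 0 (k + l)" for k l by (simp add: el_mult)
  have rr: "el 0 (?r * (?r * k)) = el 0 k" for k
  proof -
    obtain n where n: "q = Suc n" using q by (cases q) auto
    have "?r * (?r * k) = k + 2 * q * (2 * n * k)" by (simp add: n algebra_simps)
    then show ?thesis by (simp only: el_add_mult)
  qed
  have \<kappa>_pow: "\<kappa> (g \<otimes>\<^bsub>aff\<^esub> el 0 (?r * k)) = \<kappa> g \<otimes>\<^bsub>aff\<^esub> el 0 k" if g: "g \<in> carrier aff" for g k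
  proof (induction k)
    case 0 then show ?case using g by (simp add: aff_one[symmetric])
  next
    case (Suc k)
    have "g \<otimes>\<^bsub>aff\<^esub> el 0 (?r * Suc k) = g \<otimes>\<^bsub>aff\<^esub> el 0 (?r * k) \<otimes>\<^bsub>aff\<^esub> inv\<^bsub>aff\<^esub> cc"
      using g by (simp add: aff.m_assoc inv_el el_0_add add.commute)
    then have "\<kappa> (g \<otimes>\<^bsub>aff\<^esub> el 0 (?r * Suc k)) = \<kappa> g \<otimes>\<^bsub>aff\<^esub> el 0 k \<otimes>\<^bsub>aff\<^esub> cc"
      using \<kappa>_c[of "g \<otimes>\<^bsub>aff\<^esub> el 0 (?r * k)"] Suc g by simp
    then show ?case using g by (simp add: aff.m_assoc el_0_add)
  qed
  have \<kappa>_pow': "\<kappa> (g \<otimes>\<^bsub>aff\<^esub> el 0 k) = \<kappa> g \<otimes>\<^bsub>aff\<^esub> el 0 (?r * k)" if "g \<in> carrier aff" for g k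
    using \<kappa>_pow[OF that, of "?r * k"] rr by simp
  \<comment> \<open>The translation by \<open>e0\<close> is \<open>tt\<close> times the
    \<open>q\<close>-th power of \<open>cc\<close>, and that power is its own inverse.\<close>
  have \<kappa>_e0: "\<kappa> (g \<otimes>\<^bsub>aff\<^esub> el e0 0) = \<kappa> g \<otimes>\<^bsub>aff\<^esub> el e0 0" if g: "g \<in> carrier aff" for g
  proof -
    have "el 0 (?r * q) = el 0 q"
    proof -
      have "?r * q = q + 2 * q * (q - 1)" using q by (cases q) (auto simp: algebra_simps)
      then show ?thesis by (simp only: el_add_mult)
    qed
    moreover have e0: "el e0 0 = tt \<otimes>\<^bsub>aff\<^esub> el 0 q" by (simp add: el_mult el_eq_iff mult_2[symmetric])
    ultimately show ?thesis
      using \<kappa>_pow'[of "g \<otimes>\<^bsub>aff\<^esub> tt" q] \<kappa>_t g unfolding e0 by (simp add: aff.m_assoc)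
  qed
  have \<kappa>_step: "\<kappa> (g \<otimes>\<^bsub>aff\<^esub> el ((U ^^ j) e0) 0) = \<kappa> g \<otimes>\<^bsub>aff\<^esub> el ((U ^^ (?r * j)) e0) 0" if g: "g \<in> carrier aff" for g j
  proof -
    let ?m = "j * Suc q"
    have "\<kappa> (g \<otimes>\<^bsub>aff\<^esub> el ((U ^^ j) e0) 0) = \<kappa> (g \<otimes>\<^bsub>aff\<^esub> el 0 ?m \<otimes>\<^bsub>aff\<^esub> el e0 0 \<otimes>\<^bsub>aff\<^esub> el 0 (?r * ?m))"
      unfolding el_conjugate[symmetric] using g by (simp add: aff.m_assoc)
    also have "\<dots> = \<kappa> g \<otimes>\<^bsub>aff\<^esub> el 0 (?r * ?m) \<otimes>\<^bsub>aff\<^esub> el e0 0 \<otimes>\<^bsub>aff\<^esub> el 0 (?r * (?r * ?m))"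
      using g by (simp only: \<kappa>_pow' \<kappa>_e0 aff.m_closed el_in_carrier)
    also have "\<dots> = \<kappa> g \<otimes>\<^bsub>aff\<^esub> (el 0 (?r * j * Suc q) \<otimes>\<^bsub>aff\<^esub> el e0 0 \<otimes>\<^bsub>aff\<^esub> el 0 (?r * (?r * j * Suc q)))"
      using g \<kappa> by (simp only: aff.m_assoc mult.assoc aff.m_closed el_in_carrier closed)
    finally show ?thesis by (simp only: el_conjugate)
  qed
  have \<kappa>_scale: "\<kappa> (g \<otimes>\<^bsub>aff\<^esub> el (scale m ((U ^^ j) e0)) 0) = \<kappa> g \<otimes>\<^bsub>aff\<^esub> el (scale m ((U ^^ (?r * j)) e0)) 0"
    if g: "g \<in> carrier aff" for g j m
  proof -
    have el_add: "el x 0 \<otimes>\<^bsub>aff\<^esub> el y 0 = el (x + y) 0" for x y by (simp add: el_mult)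
    have nat: "\<kappa> (g \<otimes>\<^bsub>aff\<^esub> el (scale (int n) ((U ^^ j) e0)) 0) = \<kappa> g \<otimes>\<^bsub>aff\<^esub> el (scale (int n) ((U ^^ (?r * j)) e0)) 0"
      for n
    proof (induction n)
      case 0 then show ?case using g by (simp add: aff_one[symmetric])
    next
      case (Suc n)
      then show ?case
        using \<kappa>_step[of "g \<otimes>\<^bsub>aff\<^esub> el (scale (int n) ((U ^^ j) e0)) 0" j] g
        by (simp add: aff.m_assoc el_add scale_add_left add.commute)
    qed
    let ?N = "int (n1 * n2 * n3)"
    have mod: "el (scale (m mod ?N) x) 0 = el (scale m x) 0" for x
    proof -
      have "?N dvd m mod ?N - m" by (simp add: mod_eq_dvd_iff[symmetric])
      then have "scale (m mod ?N - m) x \<in> K"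
        by (cases x) (auto simp: K_def intro: dvd_mult2 dvd_trans)
      then show ?thesis
        using scale_add_left[of "m mod ?N" "- m" x] by (simp add: scale_uminus el_eq_iff)
    qed
    show ?thesis using nat[of "nat (m mod ?N)"] pos mod by simp
  qed
  have sum: "\<kappa> (el (\<Sum>j<k. scale (f j) ((U ^^ j) e0)) 0) =
    \<kappa> \<one>\<^bsub>aff\<^esub> \<otimes>\<^bsub>aff\<^esub> el (\<Sum>j<k. scale (f j) ((U ^^ (?r * j)) e0)) 0" for k
  proof (induction k)
    case 0 then show ?case by (simp add: aff_one[symmetric])
  next
    case (Suc k)
    have el_add: "el (x + y) 0 = el x 0 \<otimes>\<^bsub>aff\<^esub> el y 0" for x y by (simp add: el_mult)
    show ?case using \<kappa>_scale[OF el_in_carrier] Suc by (simp add: el_add aff.m_assoc)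
  qed
  let ?R = "\<Sum>j\<le>d. scale (f j) ((U ^^ (?r * j)) e0)"
  have "el (\<Sum>j\<le>d. scale (f j) ((U ^^ j) e0)) 0 = \<one>\<^bsub>aff\<^esub>"
    using relation by (simp add: aff_one el_eq_iff)
  then have "\<kappa> \<one>\<^bsub>aff\<^esub> \<otimes>\<^bsub>aff\<^esub> el ?R 0 = \<kappa> \<one>\<^bsub>aff\<^esub>"
    using sum[of "Suc d"] by (simp add: lessThan_Suc_atMost)
  then have "el ?R 0 = \<one>\<^bsub>aff\<^esub>" by simp
  then have "?R \<in> K" by (simp add: aff_one el_eq_iff)
  then have zero: "red ((U ^^ d) ?R) = 0" using U_pow_K by (simp add: red_zero_iff)
  have "red (\<Sum>j\<in>A. scale (f j) ((U ^^ d) ((U ^^ (?r * j)) e0))) = red (\<Sum>j\<in>A. scale (f j) ((U ^^ (d - j)) e0))"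
    if "A \<subseteq> {..d}" for A
    using finite_subset[OF that finite_atMost] that
  proof (induction A rule: finite_induct)
    case (insert j A)
    \<comment> \<open>Modulo \<open>q\<close> the exponent is \<open>d - j\<close>, natural since
      \<open>j \<le> d\<close>.\<close>
    have "d + ?r * j = d - j + q * (2 * j)"
      using insert.prems q by (cases "2 * q") (auto simp: algebra_simps)
    then have "red ((U ^^ d) ((U ^^ (?r * j)) e0)) = red ((U ^^ (d - j)) e0)"
      using red_U_pow_add_mult[of "d - j" "2 * j" e0] comp_apply[of "U ^^ d" "U ^^ (?r * j)" e0]
      by (simp only: funpow_add[symmetric])
    then have "red (scale (f j) ((U ^^ d) ((U ^^ (?r * j)) e0))) = red (scale (f j) ((U ^^ (d - j)) e0))"
      by (rule red_scale_cong)
    from red_cong_add[OF this insert.IH] show ?case using insert.hyps insert.prems by simp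
  qed simp
  from this[of "{..d}"] have "red ((U ^^ d) ?R) = red (\<Sum>j\<le>d. scale (f j) ((U ^^ (d - j)) e0))"
    by (simp add: U_pow_sum U_pow_scale)
  from trans[OF this[symmetric] zero] show False using no_reversed_relation by (simp only: red_zero_iff)
qed

theorem nat_chiral_polyhedron_exists:
  "\<exists>(P :: nat set) r rk. chiral_polyhedron P r rk \<and> non_tight P r rk \<and>
    card (carrier (poset_aut P r)) = 2 * q * (n1 * n2 * n3)"
  unfolding card_carrier_aff[symmetric]
  by (rule rotary_group.nat_chiral_polyhedron_exists[OF rotary_aff _ non_tight_aff])
    (erule no_reflection_aff; blast)

end

section \<open>Three families of modules\<close>

text \<open>Coordinates refer to the basis \<open>1, U\<close>; the third one has modulus 1. The
  relation is \<open>U^2 - 5 U + 7 = 0\<close>, while the reversed \<open>7 U^2 - 5 U + 1\<close>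
  reduces to \<open>30 U - 48\<close>, which is nonzero modulo 9.\<close>

lemma chiral_module_3_pow_4:
  assumes U: "\<And>a b c. U (a, b, c) = (- 7 * b, a + 5 * b, 0)"
  shows "chiral_module_automorphism 9 9 (Suc 0) 3 U 9 2
     (\<lambda>j. if j = 0 then 7 else if j = 1 then - 5 else 1)"
proof -
  interpret finite_module_automorphism 9 9 "Suc 0" 3 U
  proof
    fix x :: triple
    obtain a b c where x: "x = (a, b, c)" by (cases x)
    have "(U ^^ 3) x - x = (9 * (- 4 * a - 14 * b), 9 * (2 * a + 6 * b), - c)"
      by (simp add: U x numeral_3_eq_3)
    then show "(U ^^ 3) x - x \<in> {(a, b, c). int 9 dvd a \<and> int 9 dvd b \<and> int (Suc 0) dvd c}"
      by simp
  qed (auto simp: U algebra_simps)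
  have K_iff: "(a, b, c) \<in> K \<longleftrightarrow> 9 dvd a \<and> 9 dvd b" for a b c
    by (simp add: K_def)
  \<comment> \<open>The sum of the first two coordinates modulo 3 is invariant under
    \<open>U\<close> and is 1 on \<open>e0\<close>, so it reads off \<open>k\<close> from
    \<open>orbit_sum k\<close>.\<close>
  have U_pow: "3 dvd fst ((U ^^ k) e0) + fst (snd ((U ^^ k) e0)) - 1" for k
  proof (induction k)
    case (Suc k)
    then show ?case by (cases "(U ^^ k) e0") (simp add: U, presburger)
  qed (simp add: U e0_def)
  have sum: "3 dvd fst (orbit_sum k) + fst (snd (orbit_sum k)) - int k" for k
  proof (induction k)
    case (Suc k)
    then show ?case using U_pow[of k] unfolding orbit_sum_def by simp presburger
  qed (simp add: orbit_sum_def)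
  show ?thesis
  proof
    fix x :: triple
    obtain a b c where "x = (a, b, c)" by (cases x)
    then have "x - (scale a e0 + scale b (U e0) + scale 0 (U (U e0))) \<in> K"
      by (simp add: U e0_def K_iff)
    then show "\<exists>a b c. x - (scale a e0 + scale b (U e0) + scale c (U (U e0))) \<in> K" by blast
  next
    fix k assume "orbit_sum k \<in> K"
    then show "3 dvd k" using sum[of k] by (cases "orbit_sum k") (simp add: K_iff, presburger)
  next
    show "scale (int 9) (orbit_sum 3) \<in> K" by (cases "orbit_sum 3") (simp add: K_iff)
  qed (simp_all add: U e0_def K_iff numeral_2_eq_2)
qed

text \<open>The ring \<open>\<int>[z] / (z\<^sup>3 - p, z\<^sup>4, p z)\<close> in the basis \<open>1, z, z\<^sup>2\<close>, with \<open>U = 1 + z\<close>.\<close>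

lemma chiral_module_p_pow_4:
  fixes p :: nat
  assumes p: "prime p" "p \<ge> 5"
    and U: "\<And>a b c. U (a, b, c) = (a + int p * c, a + b, b + c)"
  shows "chiral_module_automorphism (p ^ 2) p p p U (p ^ 2) 3
     (\<lambda>j. if j = 0 then - 1 - int p else if j = 1 then 3 else if j = 2 then - 3 else 1)"
proof -
  let ?P = "int p"
  have odd: "odd p" using p prime_odd_nat[of p] by simp
  have p_sq: "int (p ^ 2) = ?P * ?P" by (simp add: power2_eq_square)
  \<comment> \<open>Multiplication by the binomial expansion of \<open>(1 + z)^k\<close>, using
    \<open>z^3 = p\<close> and \<open>z^4 = 0\<close>.\<close>
  define g where "g k = (\<lambda>(a, b, c). (a + ?P * (int k * c + int (k choose 2) * b + int (k choose 3) * a),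
     b + int k * a, c + int k * b + int (k choose 2) * a))" for k
  define L where "L = {(a, b, c). ?P * ?P dvd a \<and> ?P dvd b \<and> ?P dvd c}"
  have L_iff: "(a, b, c) \<in> L \<longleftrightarrow> ?P * ?P dvd a \<and> ?P dvd b \<and> ?P dvd c" for a b c
    by (simp add: L_def)
  have L_zero [simp]: "0 \<in> L"
    by (simp add: L_def zero_prod_def)
  have L_add: "x + y \<in> L" if "x \<in> L" "y \<in> L" for x y
    using that by (auto simp: L_def)
  have U_L: "U x \<in> L" if "x \<in> L" for x
    using that by (auto simp: U L_def intro: mult_dvd_mono dvd_mult_left)
  have U_diff: "U (x - y) = U x - U y" for x y
    by (cases x; cases y) (simp add: U algebra_simps)
  have U_pow: "(U ^^ k) x - g k x \<in> L" for k x
  proof (induction k)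
    case 0
    then show ?case by (cases x) (simp add: g_def L_iff binomial_eq_0)
  next
    case (Suc k)
    obtain a b c where x: "x = (a, b, c)" by (cases x)
    have "U (g k x) - g (Suc k) x = (0, ?P * (int k * c + int (k choose 2) * b + int (k choose 3) * a), 0)"
      by (simp add: U x g_def numeral_3_eq_3 numeral_2_eq_2 algebra_simps)
    then have "U (g k x) - g (Suc k) x \<in> L" by (simp add: L_iff)
    from L_add[OF U_L[OF Suc] this] show ?case by (simp only: U_diff) simp
  qed
  interpret finite_module_automorphism "p ^ 2" p p p U
  proof
    show "p ^ 2 > 0" "p > 0" "odd p" "p > 1" using p odd by auto
    fix x y :: triple
    show "U (x + y) = U x + U y" by (cases x; cases y) (simp add: U algebra_simps)
    \<comment> \<open>As \<open>p > 3\<close>, both coefficients are divisible by \<open>p\<close>,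
      so \<open>(1 + z)^p\<close> acts trivially.\<close>
    have "p dvd (p choose 2)" "p dvd (p choose 3)"
      using p by (auto intro!: dvd_choose_prime)
    then obtain u v where uv: "int (p choose 2) = ?P * u" "int (p choose 3) = ?P * v"
      by (metis dvd_def of_nat_mult)
    obtain a b c where x: "x = (a, b, c)" by (cases x)
    have "g p x - x \<in> L" by (simp add: U x g_def L_iff uv mult.assoc distrib_left[symmetric])
    from L_add[OF U_pow[of p x] this] have "(U ^^ p) x - x \<in> L" by simp
    then show "(U ^^ p) x - x \<in> {(a, b, c). int (p ^ 2) dvd a \<and> int p dvd b \<and> int p dvd c}"
      by (simp only: L_def p_sq)
  next
    fix a b c assume "int (p ^ 2) dvd a" "int p dvd b" "int p dvd c"
    then have "(a, b, c) \<in> L" by (simp only: L_iff p_sq)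
    from U_L[OF this] show "U (a, b, c) \<in> {(a, b, c). int (p ^ 2) dvd a \<and> int p dvd b \<and> int p dvd c}"
      by (simp only: L_def p_sq)
  qed
  have K_L: "K = L" by (simp only: K_def L_def p_sq)
  \<comment> \<open>Setting \<open>z = 0\<close> modulo \<open>p\<close> sends \<open>U\<close> to 1
    and \<open>orbit_sum k\<close> to \<open>k\<close>.\<close>
  have sum: "?P dvd fst (orbit_sum k) - int k" for k
  proof (induction k)
    case (Suc k)
    have "(U ^^ k) e0 - g k e0 \<in> L" by (rule U_pow)
    then have "?P dvd fst ((U ^^ k) e0) - (1 + ?P * int (k choose 3))"
      by (cases "(U ^^ k) e0") (auto simp: g_def e0_def L_iff intro: dvd_mult_left)
    moreover have "fst ((U ^^ k) e0) - 1 = fst ((U ^^ k) e0) - (1 + ?P * int (k choose 3)) + ?P * int (k choose 3)"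
      by simp
    ultimately have "?P dvd fst ((U ^^ k) e0) - 1" by (metis dvd_add dvd_triv_left)
    from dvd_add[OF this Suc] show ?case unfolding orbit_sum_def by (simp add: U algebra_simps)
  qed (simp add: orbit_sum_def)
  show ?thesis
  proof
    fix x :: triple
    obtain a b c where "x = (a, b, c)" by (cases x)
    \<comment> \<open>The coefficients come from expanding \<open>a + b z + c z^2\<close> with
      \<open>z = U - 1\<close>.\<close>
    then have "x - (scale (a - b + c) e0 + scale (b - 2 * c) (U e0) + scale c (U (U e0))) = 0"
      by (simp add: U e0_def zero_prod_def)
    then show "\<exists>a b c. x - (scale a e0 + scale b (U e0) + scale c (U (U e0))) \<in> K" by (metis K_zero)
  next
    fix k assume "orbit_sum k \<in> K"
    then have "?P dvd fst (orbit_sum k)" by (cases "orbit_sum k") (auto simp: K_L L_iff intro: dvd_mult_left)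
    from dvd_diff[OF this sum[of k]] show "p dvd k" by simp
  next
    show "0 < p ^ 2" using p by simp
    show "p * p ^ 2 < p ^ 2 * p * p" using p by (simp add: power2_eq_square)
    show "scale (int (p ^ 2)) (orbit_sum p) \<in> K"
      unfolding K_L by (cases "orbit_sum p") (simp add: L_iff power2_eq_square)
    \<comment> \<open>This is \<open>(U - 1)^3 - p\<close>, that is \<open>z^3 - p\<close>.\<close>
    show "(\<Sum>j\<le>3. scale (if j = 0 then - 1 - int p else if j = 1 then 3 else if j = 2 then - 3 else 1)
       ((U ^^ j) e0)) \<in> K"
      unfolding K_L by (simp add: U e0_def L_iff numeral_3_eq_3 numeral_2_eq_2)
    \<comment> \<open>The reversed relation is \<open>- z^3 - p U^3\<close>, which equals
      \<open>- p (2 + p)\<close> because \<open>p z = 0\<close>.\<close>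
    have "\<not> ?P dvd 2"
      using p by (auto dest: zdvd_imp_le)
    then have "\<not> ?P dvd 2 + ?P" by simp
    then have "\<not> ?P * ?P dvd ?P * (2 + ?P)" using p by simp
    then have "\<not> ?P * ?P dvd - (?P * (2 + ?P))" by simp
    then show "(\<Sum>j\<le>3. scale (if j = 0 then - 1 - int p else if j = 1 then 3 else if j = 2 then - 3 else 1)
       ((U ^^ (3 - j)) e0)) \<notin> K"
      unfolding K_L by (simp add: U e0_def L_iff numeral_3_eq_3 numeral_2_eq_2 algebra_simps)
  qed
qed

text \<open>
  The ring \<open>\<int>[z] / (z\<^sup>2, p\<^bsup>j+1\<^esup> - p z, p\<^sup>2 z)\<close> with \<open>U = 1 + z\<close>. In the basis \<open>1, z - p\<^sup>j\<close> the
  additive group becomes a direct product, since \<open>p (z - p\<^sup>j) = 0\<close>.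
\<close>

lemma chiral_module_p_pow_ge_4:
  fixes p j :: nat
  assumes p: "prime p" "odd p" and j: "j \<ge> 1"
  defines "u \<equiv> int p ^ j"
  assumes U: "\<And>a b c. U (a, b, c) = (a + u * (a - u * b), a + b, 0)"
  shows "chiral_module_automorphism (p ^ (j + 2)) p (Suc 0) (p ^ 2) U (p ^ j) (Suc 0)
     (\<lambda>j. if j = 0 then int p * u + int p else - int p)"
proof -
  let ?P = "int p"
  obtain v where v: "u = ?P * v" using j by (cases j) (auto simp: u_def)
  have u_pos: "u > 0" using p prime_gt_0_nat by (simp add: u_def)
  have n1: "int (p ^ (j + 2)) = ?P * ?P * u" by (simp add: u_def power_add power2_eq_square)
  \<comment> \<open>The action of \<open>1 + k z\<close>, since \<open>z^2 = 0\<close>;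
    \<open>z\<close> takes \<open>(a, b)\<close> to \<open>(u (a - u b), a)\<close>.\<close>
  define g where "g k = (\<lambda>(a, b, c :: int). (a + int k * (u * (a - u * b)), b + int k * a, 0 :: int))" for k
  define L where "L = {(a, b, c :: int). ?P * ?P * u dvd a \<and> ?P dvd b}"
  have L_iff: "(a, b, c) \<in> L \<longleftrightarrow> ?P * ?P * u dvd a \<and> ?P dvd b" for a b c
    by (simp add: L_def)
  have L_zero [simp]: "0 \<in> L"
    by (simp add: L_def zero_prod_def)
  have L_add: "x + y \<in> L" if "x \<in> L" "y \<in> L" for x y
    using that by (auto simp: L_def)
  have U_L: "U x \<in> L" if xL: "x \<in> L" for x
  proof -
    obtain a b c where x: "x = (a, b, c)" by (cases x)
    obtain a' b' where "a = ?P * ?P * u * a'" "b = ?P * b'"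
      using xL unfolding x L_iff dvd_def by blast
    then have "a + u * (a - u * b) = ?P * ?P * u * (a' + u * a' - v * b')" "a + b = ?P * (?P * u * a' + b')"
      by (simp_all add: v algebra_simps)
    then show ?thesis by (simp add: U x L_iff)
  qed
  have U_diff: "U (x - y) = U x - U y" for x y
    by (cases x; cases y) (simp add: U algebra_simps)
  have U_pow: "(U ^^ k) x - g k x \<in> L" for k x
  proof (induction k)
    case 0
    then show ?case by (cases x) (simp add: g_def L_iff)
  next
    case (Suc k)
    obtain a b c where x: "x = (a, b, c)" by (cases x)
    \<comment> \<open>The difference is \<open>k z^2 x\<close>, which vanishes modulo
      \<open>L\<close> because \<open>p\<close> divides \<open>u\<close>.\<close>
    have "U (g k x) - g (Suc k) x = (?P * ?P * u * (- int k * v * v * b), ?P * (int k * v * (a - u * b)), 0)"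
      by (simp add: U x g_def v algebra_simps)
    then have "U (g k x) - g (Suc k) x \<in> L" by (simp add: L_iff)
    from L_add[OF U_L[OF Suc] this] show ?case by (simp only: U_diff) simp
  qed
  have L_eq: "{(a, b, c). int (p ^ (j + 2)) dvd a \<and> int p dvd b \<and> int (Suc 0) dvd c} = L"
    by (simp only: L_def n1) simp
  interpret finite_module_automorphism "p ^ (j + 2)" p "Suc 0" "p ^ 2" U
  proof (unfold_locales, unfold L_eq)
    show "p ^ (j + 2) > 0" "p > 0" "Suc 0 > 0" "odd (p ^ 2)" using p prime_gt_0_nat by auto
    show "p ^ 2 > 1" using p prime_gt_1_nat[of p] by (intro one_less_power) auto
    fix x y :: triple
    show "U (x + y) = U x + U y" by (cases x; cases y) (simp add: U algebra_simps)
    obtain a b c where x: "x = (a, b, c)" by (cases x)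
    have "g (p ^ 2) x - x \<in> L" by (simp add: U x g_def L_iff power2_eq_square)
    from L_add[OF U_pow[of "p ^ 2" x] this] show "(U ^^ p ^ 2) x - x \<in> L" by simp
  next
    fix a b c assume "int (p ^ (j + 2)) dvd a" "int p dvd b" "int (Suc 0) dvd c"
    then have "(a, b, c) \<in> L" by (simp only: L_iff n1)
    from U_L[OF this] show "U (a, b, c) \<in> L" .
  qed
  have K_L: "K = L" by (simp only: K_def L_eq)
  \<comment> \<open>The sum of \<open>1 + i z\<close> over \<open>i < k\<close>, with
    \<open>z\<close> written as \<open>u\<close> plus the second basis vector.\<close>
  have sum: "orbit_sum k - (int k + int (k choose 2) * u, int (k choose 2), 0) \<in> L" for k
  proof (induction k)
    case (Suc k)
    have "(U ^^ k) e0 - g k e0 \<in> L" by (rule U_pow)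
    from L_add[OF Suc this] show ?case
      unfolding orbit_sum_def by (simp add: g_def e0_def numeral_2_eq_2 algebra_simps)
  qed (simp add: orbit_sum_def L_iff zero_prod_def binomial_eq_0)
  have coprime: "coprime ?P (2 + ?P * x)" for x
  proof -
    have "coprime p 2" using p by (simp add: coprime_commute)
    then have "coprime ?P 2" by (metis coprime_int_iff of_nat_numeral)
    then show ?thesis using gcd_add_mult[of ?P x 2] by (simp add: coprime_iff_gcd_eq_1 ac_simps)
  qed
  have choose2: "2 * int (k choose 2) = int k * (int k - 1)" for k
    by (induction k) (simp_all add: numeral_2_eq_2 algebra_simps)
  show ?thesis
  proof
    fix x :: triple
    obtain a b c where "x = (a, b, c)" by (cases x)
    then have "x - (scale (a - (1 + u) * b) e0 + scale b (U e0) + scale 0 (U (U e0))) \<in> K"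
      unfolding K_L by (simp add: U e0_def L_iff algebra_simps)
    then show "\<exists>a b c. x - (scale a e0 + scale b (U e0) + scale c (U (U e0))) \<in> K" by blast
  next
    fix k assume "orbit_sum k \<in> K"
    then have "orbit_sum k - (orbit_sum k - (int k + int (k choose 2) * u, int (k choose 2), 0)) \<in> K"
      using sum[of k] K_diff by (simp only: K_L)
    then have "?P * ?P * u dvd int k + int (k choose 2) * u" unfolding K_L by (simp add: L_iff add.commute)
    \<comment> \<open>Doubling clears the binomial coefficient; then \<open>k\<close> factors out
      and the cofactor is prime to \<open>p\<close>.\<close>
    then have "?P * ?P dvd 2 * (int k + int (k choose 2) * u)" by (meson dvd_mult dvd_mult_left)
    also have "2 * (int k + int (k choose 2) * u) = 2 * int k + (2 * int (k choose 2)) * u"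
      by simp
    also have "\<dots> = int k * (2 + ?P * ((int k - 1) * v))"
      unfolding choose2 by (simp add: v algebra_simps)
    finally have "?P * ?P dvd int k"
      using coprime by (simp add: coprime_dvd_mult_left_iff)
    then show "p ^ 2 dvd k"
      by (metis of_nat_mult of_nat_dvd_iff power2_eq_square)
  next
    show "0 < p ^ j" using p prime_gt_0_nat by simp
    show "p ^ 2 * p ^ j < p ^ (j + 2) * p * Suc 0"
      using p prime_gt_1_nat[of p] by (simp add: power_add power2_eq_square mult.commute)
    let ?C = "int (p ^ 2 choose 2)"
    \<comment> \<open>Since \<open>p ^ 2\<close> is odd, \<open>p ^ 2\<close> divides
      \<open>p ^ 2 choose 2\<close>, so \<open>u\<close> already annihilates the orbit sum.\<close>
    obtain w where "p ^ 2 = 2 * w + 1" using p by (metis oddE even_power)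
    then have "int (p ^ 2) - 1 = 2 * int w" by linarith
    then have "2 * ?C = int (p ^ 2) * (2 * int w)" using choose2[of "p ^ 2"] by (simp only:)
    then have "?C = ?P * ?P * int w" by (simp add: power2_eq_square)
    then have "scale u (int (p ^ 2) + ?C * u, ?C, 0) \<in> L"
      by (simp add: L_iff power2_eq_square v distrib_left)
    moreover have "scale u (orbit_sum (p ^ 2) - (int (p ^ 2) + ?C * u, ?C, 0)) \<in> L"
      using scale_K sum K_L by blast
    ultimately have "scale u (orbit_sum (p ^ 2) - (int (p ^ 2) + ?C * u, ?C, 0) + (int (p ^ 2) + ?C * u, ?C, 0)) \<in> L"
      unfolding scale_add_right by (rule L_add[rotated])
    then show "scale (int (p ^ j)) (orbit_sum (p ^ 2)) \<in> K"
      unfolding K_L by (simp add: u_def)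
    \<comment> \<open>This is \<open>p (u - z)\<close>, zero by the choice of the second basis
      vector.\<close>
    show "(\<Sum>j\<le>Suc 0. scale (if j = 0 then int p * u + int p else - int p) ((U ^^ j) e0)) \<in> K"
      unfolding K_L by (simp add: U e0_def L_iff algebra_simps)
    \<comment> \<open>The first coordinate of the reversed relation is \<open>p u (2 + u)\<close>,
      where \<open>u = p v\<close>; it is not divisible by \<open>p^2 u\<close> as \<open>p\<close>
      is odd.\<close>
    have "\<not> ?P dvd 2 + ?P * v"
      using coprime_common_divisor[OF coprime dvd_refl, of v] p prime_gt_1_nat[of p] by auto
    then have "\<not> ?P * u * ?P dvd ?P * u * (2 + ?P * v)" using p u_pos by simp
    moreover have "?P * u * (2 + ?P * v) = (?P * u + ?P) * (1 + u) - ?P" by (simp add: v algebra_simps)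
    moreover have "?P * u * ?P = ?P * ?P * u" by simp
    ultimately have "\<not> ?P * ?P * u dvd (?P * u + ?P) * (1 + u) - ?P" by metis
    then show "(\<Sum>j\<le>Suc 0. scale (if j = 0 then int p * u + int p else - int p) ((U ^^ (Suc 0 - j)) e0)) \<notin> K"
      unfolding K_L by (simp add: U e0_def L_iff)
  qed
qed

theorem theorem1p4:
  fixes p m :: nat
  assumes "prime p" and "odd p"
    and "m \<ge> 5"
    and "odd m \<or> (even m \<and> m \<ge> p + 3)"
  shows "\<exists>(P :: nat set) r rk.
           chiral_polyhedron P r rk \<and> non_tight P r rk \<and>
           card (carrier (poset_aut P r)) = 2 * p ^ m"
proof (cases "m = 5")
  case True
  have "p \<noteq> 2" "p \<noteq> 4" using \<open>odd p\<close> by auto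
  then consider "p = 3" | "p \<ge> 5"
    using prime_ge_2_nat[OF \<open>prime p\<close>] by linarith
  then show ?thesis
  proof cases
    case 1
    have module: "chiral_module_automorphism 9 9 (Suc 0) 3 (\<lambda>(a, b, c). (- 7 * b, a + 5 * b, 0)) 9 2
      (\<lambda>j. if j = 0 then 7 else if j = 1 then - 5 else 1)"
      by (rule chiral_module_3_pow_4) simp
    have card: "2 * 3 * (9 * 9 * Suc 0) = 2 * p ^ m"
      using True 1 by simp
    from chiral_module_automorphism.nat_chiral_polyhedron_exists[OF module]
  show ?thesis unfolding card .
  next
    case 2
    have module: "chiral_module_automorphism (p ^ 2) p p p (\<lambda>(a, b, c). (a + int p * c, a + b, b + c)) (p ^ 2) 3
      (\<lambda>j. if j = 0 then - 1 - int p else if j = 1 then 3 else if j = 2 then - 3 else 1)"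
      by (rule chiral_module_p_pow_4[OF \<open>prime p\<close> 2]) simp
    have card: "2 * p * (p ^ 2 * p * p) = 2 * p ^ m"
      using True by (simp add: eval_nat_numeral algebra_simps)
    from chiral_module_automorphism.nat_chiral_polyhedron_exists[OF module]
  show ?thesis unfolding card .
  qed
next
  case False
  then obtain j where j: "j \<ge> 1" "m = j + 5"
    using \<open>m \<ge> 5\<close> that[of "m - 5"] by simp
  \<comment> \<open>The module has \<open>p ^ (m - 2)\<close> elements and the cyclic factor has
    order \<open>2 * p ^ 2\<close>.\<close>
  have module: "chiral_module_automorphism (p ^ (j + 2)) p (Suc 0) (p ^ 2)
    (\<lambda>(a, b, c). (a + int p ^ j * (a - int p ^ j * b), a + b, 0)) (p ^ j) (Suc 0)
    (\<lambda>i. if i = 0 then int p * int p ^ j + int p else - int p)"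
    by (rule chiral_module_p_pow_ge_4[OF \<open>prime p\<close> \<open>odd p\<close> j(1)]) simp
  have card: "2 * p ^ 2 * (p ^ (j + 2) * p * Suc 0) = 2 * p ^ m"
    by (simp add: j(2) eval_nat_numeral power_add algebra_simps)
  from chiral_module_automorphism.nat_chiral_polyhedron_exists[OF module]
  show ?thesis unfolding card .
qed

end
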